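(* Let $\mathscr{V}$ be a topological category over $\mathsf{Set}$, with topological functor $|-| : \mathscr{V} \to \mathsf{Set}$, equipped with the cartesian symmetric monoidal structure $(\otimes, I) = (\times, 1)$, and suppose that $\mathscr{V}$ is cartesian closed. Let $\mathcal{S}$ be a set, let $\mathcal{T} = (\Sigma, \mathcal{E})$ be a $\mathscr{V}$-enriched $\mathcal{S}$-sorted equational theory, and let $F^\Sigma : \mathscr{V}^{\mathcal{S}} \to \Sigma\text{-}\mathsf{Alg}$ be the left adjoint of $U^\Sigma : \Sigma\text{-}\mathsf{Alg} \to \mathscr{V}^{\mathcal{S}}$. Let $X$ be an object of $\mathscr{V}^{\mathcal{S}}$, and let $\sim^{\mathcal{E}}$ be the $\Sigma$-congruence on the free $\Sigma$-algebra $F^\Sigma X$ generated by $\mathcal{E}$. Then the $\Sigma$-algebra $F^\Sigma X/{\sim^{\mathcal{E}}}$ is the free $\mathcal{T}$-algebra $F^{\mathcal{T}} X$ on $X$.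
   Context: Topological categories. A concrete category over $\mathsf{Set}$ is a category $\mathscr{V}$ with a faithful functor $|-| : \mathscr{V} \to \mathsf{Set}$; a function $f : |V| \to |W|$ is admissible if it lifts (uniquely) to a morphism $V \to W$. The fibre $\mathsf{Fib}(Y)$ over a set $Y$ is the preordered class of objects $V$ with $|V| = Y$, where $V \leq V'$ iff $1_Y$ is an admissible morphism $V \to V'$; $\mathscr{V}$ is amnestic if all fibres are partially ordered. A (possibly large) source $(f_i : V \to V_i)_{i}$ is initial if for all $W$ and $f : |W| \to |V|$, $f$ is admissible iff all $f_i \circ f$ are; final sinks are defined dually. $\mathscr{V}$ is topological over $\mathsf{Set}$ if it is amnestic and every (possibly large) structured source $(f_i : Y \to |V_i|)_i$ has an initial lift: an object $V$ with $|V| = Y$, each $f_i$ admissible, and $(f_i : V \to V_i)_i$ initial. Then dually every structured sink $(g_i : |V_i| \to Y)_i$ has a final lift $(g_i : V_i \to V)_i$, and $V$ is called the final structure on $Y$ induced by the $g_i$. The indiscrete object $\mathsf{Indisc}\, Y$ on a set $Y$ is the greatest element of $\mathsf{Fib}(Y)$. One has $|X \times Y| = |X| \times |Y|$. For $V \in \mathscr{V}^{\mathcal{S}}$, $|V| := (|V_S|)_S$. Signatures (with $\otimes = \times$). $\mathcal{S}^*$ is the set of finite sequences of elements of $\mathcal{S}$. A $\mathscr{V}$-enriched $\mathcal{S}$-sorted signature is a set $\Sigma$ of operation symbols, each equipped with a type $((S_1, \ldots, S_n), S, P)$: input sorts $(S_1,\ldots,S_n) \in \mathcal{S}^*$, output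 sort $S \in \mathcal{S}$, parameter object $P \in \mathrm{ob}\,\mathscr{V}$. A $\Sigma$-algebra is an object $A = (A_S)_{S}$ of $\mathscr{V}^{\mathcal{S}}$ with, for each such $\sigma \in \Sigma$, a $\mathscr{V}$-morphism $\sigma^A : P \times (A_{S_1} \times \cdots \times A_{S_n}) \to A_S$. A morphism $f : A \to B$ of $\Sigma$-algebras is a morphism of $\mathscr{V}^{\mathcal{S}}$ with $f_S \circ \sigma^A = \sigma^B \circ (1_P \times (f_{S_1} \times \cdots \times f_{S_n}))$ for all $\sigma$. These form $\Sigma\text{-}\mathsf{Alg}$, with forgetful functor $U^\Sigma$ to $\mathscr{V}^{\mathcal{S}}$, which has a left adjoint $F^\Sigma$. A classical $\mathcal{S}$-sorted signature is the case $\mathscr{V} = \mathsf{Set}$ with all parameters equal to the one-point set. $|\Sigma|$ is the classical signature with an operation symbol $\sigma_p$ with input sorts $(S_1,\ldots,S_n)$ and output sort $S$ for each $\sigma \in \Sigma$ of type $((S_1,\ldots,S_n),S,P)$ and each $p \in |P|$. Each $\Sigma$-algebra $A$ has an underlying $|\Sigma|$-algebra $|A|$ with carrier $(|A_S|)_S$ and $\sigma_p^{|A|} = \sigma^A(p, -)$. Enriched theories. For $P \in \mathrm{ob}\,\mathscr{V}$ and $\overline{S} = (S_1, \ldots, S_n) \in \mathcal{S}^*$, let $P \times U^{\overline{S}} : \Sigma\text{-}\mathsf{Alg} \to \mathscr{V}$ be $A \mapsto P \times (A_{S_1} \times \cdots \times A_{S_n})$, and $U^S$ be $A \mapsto A_S$.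 An algebraic $\Sigma$-operation of type $(\overline{S}, S, P)$ is a natural transformation $\omega : P \times U^{\overline{S}} \Rightarrow U^S$. An algebraic $\Sigma$-equation $\omega \doteq \nu$ is a pair of algebraic $\Sigma$-operations of the same type; $A$ satisfies it if $\omega_A = \nu_A$. A $\mathscr{V}$-enriched $\mathcal{S}$-sorted equational theory is a pair $\mathcal{T} = (\Sigma, \mathcal{E})$ with $\mathcal{E}$ a set of algebraic $\Sigma$-equations; $\mathcal{T}\text{-}\mathsf{Alg} \subseteq \Sigma\text{-}\mathsf{Alg}$ is the full subcategory of $\mathcal{T}$-algebras, i.e. $\Sigma$-algebras satisfying all equations in $\mathcal{E}$, and $U^{\mathcal{T}} : \mathcal{T}\text{-}\mathsf{Alg} \to \mathscr{V}^{\mathcal{S}}$ is the restriction of $U^\Sigma$. The free $\mathcal{T}$-algebra on $X$ is the value at $X$ of the left adjoint $F^{\mathcal{T}}$ of $U^{\mathcal{T}}$, i.e. a $\mathcal{T}$-algebra with a universal morphism from $X$ to its carrier. Classical syntax. With fixed pairwise disjoint countably infinite sets of variables for each sort, a context $\overline{v}$ is a finite list $v_1 : S_1, \ldots, v_n : S_n$ of pairwise distinct sorted variables. $|\Sigma|$-terms in context: each $[\overline{v} \vdash v_i : S_i]$, and $[\overline{v} \vdash \tau(t_1, \ldots, t_m) : T]$ for $\tau \in |\Sigma|$ with input sorts $T_1, \ldots, T_m$, output sort $T$, and terms $[\overline{v} \vdash t_j : T_j]$. In a $|\Sigma|$-algebra $D$ a term $[\overline{v} \vdash t : S]$ is interpreted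 as a function $t^D : D_{S_1} \times \cdots \times D_{S_n} \to D_S$ in the usual recursive way. A syntactic equation is a pair $[\overline{v} \vdash s \doteq t : S]$ of terms of the same sort in the same context. Underlying classical equations $|\mathcal{E}|$. For a $|\Sigma|$-algebra $D$, let $D^{\mathsf{Indisc}}$ be the $\Sigma$-algebra with carrier $(\mathsf{Indisc}\, D_S)_S$ and operations with underlying functions $(p, d_1, \ldots, d_n) \mapsto \sigma_p^D(d_1, \ldots, d_n)$. For an algebraic $\Sigma$-operation $\omega$ of type $((S_1, \ldots, S_n), S, P)$, $p \in |P|$, and a context $\overline{v} \equiv v_1 : S_1, \ldots, v_n : S_n$ of distinct variables, let $D$ be the $|\Sigma|$-algebra of $|\Sigma|$-terms in context $\overline{v}$ and let $t_{\omega, p} := \omega_{D^{\mathsf{Indisc}}}(p, v_1, \ldots, v_n) \in D_S$. Then $|\mathcal{E}|$ consists of the syntactic $|\Sigma|$-equations $[\overline{v} \vdash t_{\omega, p} \doteq t_{\nu, p} : S]$ for all $(\omega \doteq \nu) \in \mathcal{E}$ with parameter $P$ and all $p \in |P|$. (A $\Sigma$-algebra $A$ is a $\mathcal{T}$-algebra iff $|A|$ satisfies all equations in $|\mathcal{E}|$.) Congruences. A $\Sigma$-congruence on a $\Sigma$-algebra $A$ is a family $(\sim_S)_S$ of equivalence relations on the sets $|A_S|$ such that for all $\sigma \in \Sigma$ of type $((S_1, \ldots, S_n), S, P)$, $p \in |P|$, and $a_i \sim_{S_i} b_i$ ($1 \le i \le n$), one has $\sigma^A(p, a_1, \ldots,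 a_n) \sim_S \sigma^A(p, b_1, \ldots, b_n)$. The $\Sigma$-congruence $\sim^{\mathcal{E}}$ on $A$ generated by $\mathcal{E}$ is the smallest $\Sigma$-congruence with $s^{|A|}(a_1, \ldots, a_n) \sim_S t^{|A|}(a_1, \ldots, a_n)$ for all $[\overline{v} \vdash s \doteq t : S]$ in $|\mathcal{E}|$, $\overline{v} \equiv v_1 : S_1, \ldots, v_n : S_n$, and all $a_i \in |A_{S_i}|$. For a $\Sigma$-congruence $\sim$ on $A$, the quotient $\Sigma$-algebra $A/{\sim}$ has carrier $(A_S/{\sim_S})_S$, where $A_S/{\sim_S}$ is the set $|A_S|/{\sim_S}$ with the final structure induced by the surjection $|A_S| \to |A_S|/{\sim_S}$, and operations $\sigma^{A/\sim}(p, [a_1], \ldots, [a_n]) = [\sigma^A(p, a_1, \ldots, a_n)]$ (these are $\mathscr{V}$-morphisms since $\mathscr{V}$ is cartesian closed). *)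

theory Defs
  imports "HOL-Library.FuncSet"
begin

(* Set is the category of small subsets of a type of class set_universe and all functions
   between them.  Such a type plays the role of a Grothendieck universe; for example the type V
   of the AFP entry ZFC_in_HOL with its small sets is one.  The injection tuple makes
   (t_1, ..., t_n) an element of the universe, so that finite products of small sets are again
   subsets of the universe. *)
class set_universe =
  fixes small :: "'a set \<Rightarrow> bool"
    and tuple :: "'a list \<Rightarrow> 'a"
  assumes small_subset: "small A \<Longrightarrow> B \<subseteq> A \<Longrightarrow> small B"
    and small_image: "small A \<Longrightarrow> small (f ` A)"
    and small_UN: "small I \<Longrightarrow> (\<And>i. i \<in> I \<Longrightarrow> small (F i)) \<Longrightarrow> small (\<Union>i\<in>I. F i)"
    and small_Pow: "small A \<Longrightarrow> \<exists>e. inj_on e (Pow A) \<and> small (e ` Pow A)"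
    and small_infinite: "\<exists>A. small A \<and> infinite A"
    and inj_tuple: "inj tuple"

definition untuple :: "'u::set_universe \<Rightarrow> 'u list" where
  "untuple = inv tuple"

(* smallness of a set whose elements need not belong to the universe 'u *)
definition small_sized :: "'u::set_universe itself \<Rightarrow> 'b set \<Rightarrow> bool" where
  "small_sized _ A \<longleftrightarrow> (\<exists>f :: 'b \<Rightarrow> 'u. inj_on f A \<and> small (f ` A))"


section \<open>Topological categories over Set\<close>

(* As the functor to Set is faithful, a morphism from V to W is identified with its underlying
   function: Hom C V W is the set of admissible functions from |V| to |W|. *)
record ('u, 'v) concrete =
  Ob :: "'v set"
  Und :: "'v \<Rightarrow> 'u set"
  Hom :: "'v \<Rightarrow> 'v \<Rightarrow> ('u \<Rightarrow> 'u) set"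

definition ident :: "('u, 'v) concrete \<Rightarrow> 'v \<Rightarrow> 'u \<Rightarrow> 'u" where
  "ident C V = (\<lambda>x\<in>Und C V. x)"

locale concrete_category =
  fixes C :: "('u::set_universe, 'v) concrete"
  assumes small_Und: "V \<in> Ob C \<Longrightarrow> small (Und C V)"
    and Hom_funcset: "V \<in> Ob C \<Longrightarrow> W \<in> Ob C \<Longrightarrow> Hom C V W \<subseteq> Und C V \<rightarrow>\<^sub>E Und C W"
    and ident_Hom: "V \<in> Ob C \<Longrightarrow> ident C V \<in> Hom C V V"
    and compose_Hom: "V \<in> Ob C \<Longrightarrow> W \<in> Ob C \<Longrightarrow> Z \<in> Ob C \<Longrightarrow> f \<in> Hom C V W \<Longrightarrow>
          g \<in> Hom C W Z \<Longrightarrow> compose (Und C V) g f \<in> Hom C V Z"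

definition Fib :: "('u, 'v) concrete \<Rightarrow> 'u set \<Rightarrow> 'v set" where
  "Fib C Y = {V \<in> Ob C. Und C V = Y}"

definition fib_le :: "('u, 'v) concrete \<Rightarrow> 'v \<Rightarrow> 'v \<Rightarrow> bool" where
  "fib_le C V V' \<longleftrightarrow> ident C V \<in> Hom C V V'"

definition amnestic :: "('u, 'v) concrete \<Rightarrow> bool" where
  "amnestic C \<longleftrightarrow>
     (\<forall>Y. \<forall>V\<in>Fib C Y. \<forall>V'\<in>Fib C Y. fib_le C V V' \<longrightarrow> fib_le C V' V \<longrightarrow> V = V')"

(* A source with domain V (a structured source with domain Y, and dually for sinks) is given by
   the set G of its legs, each paired with its codomain; G is an arbitrary, possibly large, set. *)
definition initial_source :: "('u, 'v) concrete \<Rightarrow> 'v \<Rightarrow> ('v \<times> ('u \<Rightarrow> 'u)) set \<Rightarrow> bool" where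
  "initial_source C V G \<longleftrightarrow>
     (\<forall>(V', f)\<in>G. f \<in> Hom C V V') \<and>
     (\<forall>W\<in>Ob C. \<forall>h\<in>Und C W \<rightarrow>\<^sub>E Und C V.
        h \<in> Hom C W V \<longleftrightarrow> (\<forall>(V', f)\<in>G. compose (Und C W) f h \<in> Hom C W V'))"

definition final_sink :: "('u, 'v) concrete \<Rightarrow> 'v \<Rightarrow> ('v \<times> ('u \<Rightarrow> 'u)) set \<Rightarrow> bool" where
  "final_sink C V G \<longleftrightarrow>
     (\<forall>(V', g)\<in>G. g \<in> Hom C V' V) \<and>
     (\<forall>W\<in>Ob C. \<forall>h\<in>Und C V \<rightarrow>\<^sub>E Und C W.
        h \<in> Hom C V W \<longleftrightarrow> (\<forall>(V', g)\<in>G. compose (Und C V') h g \<in> Hom C V' W))"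

locale topological_category = concrete_category +
  assumes amnestic: "amnestic C"
    and initial_lift: "small Y \<Longrightarrow> (\<forall>(V, f)\<in>G. V \<in> Ob C \<and> f \<in> Y \<rightarrow>\<^sub>E Und C V) \<Longrightarrow>
          \<exists>V\<in>Fib C Y. initial_source C V G"

definition final_structure ::
    "('u, 'v) concrete \<Rightarrow> 'u set \<Rightarrow> ('v \<times> ('u \<Rightarrow> 'u)) set \<Rightarrow> 'v" where
  "final_structure C Y G = (THE V. V \<in> Fib C Y \<and> final_sink C V G)"

definition Indisc :: "('u, 'v) concrete \<Rightarrow> 'u set \<Rightarrow> 'v" where
  "Indisc C Y = (THE V. V \<in> Fib C Y \<and> (\<forall>V'\<in>Fib C Y. fib_le C V' V))"


section \<open>Finite products and cartesian closedness\<close>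

definition proj :: "('u::set_universe, 'v) concrete \<Rightarrow> 'v \<Rightarrow> nat \<Rightarrow> 'u \<Rightarrow> 'u" where
  "proj C Q i = (\<lambda>z\<in>Und C Q. untuple z ! i)"

(* Q is a categorical product of the list Vs, on the cartesian product of the underlying sets *)
definition is_product :: "('u::set_universe, 'v) concrete \<Rightarrow> 'v list \<Rightarrow> 'v \<Rightarrow> bool" where
  "is_product C Vs Q \<longleftrightarrow>
     Q \<in> Fib C (tuple ` listset (map (Und C) Vs)) \<and>
     (\<forall>i<length Vs. proj C Q i \<in> Hom C Q (Vs ! i)) \<and>
     (\<forall>W\<in>Ob C. \<forall>fs. length fs = length Vs \<longrightarrow> (\<forall>i<length Vs. fs ! i \<in> Hom C W (Vs ! i)) \<longrightarrow>
        (\<exists>!h. h \<in> Hom C W Q \<and> (\<forall>i<length Vs. compose (Und C W) (proj C Q i) h = fs ! i)))"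

definition prods :: "('u::set_universe, 'v) concrete \<Rightarrow> 'v list \<Rightarrow> 'v" where
  "prods C Vs = (THE Q. is_product C Vs Q)"

definition prods_map ::
    "('u::set_universe, 'v) concrete \<Rightarrow> 'v list \<Rightarrow> ('u \<Rightarrow> 'u) list \<Rightarrow> 'u \<Rightarrow> 'u" where
  "prods_map C Vs fs = (\<lambda>z\<in>Und C (prods C Vs). tuple (map2 (\<lambda>f x. f x) fs (untuple z)))"

definition cartesian_closed :: "('u::set_universe, 'v) concrete \<Rightarrow> bool" where
  "cartesian_closed C \<longleftrightarrow>
     (\<forall>V\<in>Ob C. \<forall>W\<in>Ob C. \<exists>E\<in>Ob C. \<exists>ev\<in>Hom C (prods C [E, V]) W.
        \<forall>Z\<in>Ob C. \<forall>f\<in>Hom C (prods C [Z, V]) W.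
          \<exists>!g. g \<in> Hom C Z E \<and>
            compose (Und C (prods C [Z, V])) ev (prods_map C [Z, V] [g, ident C V]) = f)"


section \<open>The power category indexed by a set of sorts\<close>

definition pow_Ob :: "('u, 'v) concrete \<Rightarrow> 's set \<Rightarrow> ('s \<Rightarrow> 'v) set" where
  "pow_Ob C S = S \<rightarrow>\<^sub>E Ob C"

definition pow_Hom ::
    "('u, 'v) concrete \<Rightarrow> 's set \<Rightarrow> ('s \<Rightarrow> 'v) \<Rightarrow> ('s \<Rightarrow> 'v) \<Rightarrow> ('s \<Rightarrow> 'u \<Rightarrow> 'u) set" where
  "pow_Hom C S X Y = (\<Pi>\<^sub>E s\<in>S. Hom C (X s) (Y s))"

(* composite of h after f, where X is the domain of f *)
definition pow_comp ::
    "('u, 'v) concrete \<Rightarrow> 's set \<Rightarrow> ('s \<Rightarrow> 'v) \<Rightarrow> ('s \<Rightarrow> 'u \<Rightarrow> 'u) \<Rightarrow> ('s \<Rightarrow> 'u \<Rightarrow> 'u)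
       \<Rightarrow> 's \<Rightarrow> 'u \<Rightarrow> 'u" where
  "pow_comp C S X h f = (\<lambda>s\<in>S. compose (Und C (X s)) (h s) (f s))"


section \<open>Enriched signatures and their algebras\<close>

record ('f, 's) signature =
  syms :: "'f set"
  ins :: "'f \<Rightarrow> 's list"
  out :: "'f \<Rightarrow> 's"

record ('f, 's, 'v) enriched_signature = "('f, 's) signature" +
  par :: "'f \<Rightarrow> 'v"

definition is_enriched_signature ::
    "('u::set_universe, 'v) concrete \<Rightarrow> 's set \<Rightarrow> ('f, 's, 'v) enriched_signature \<Rightarrow> bool" where
  "is_enriched_signature C S \<Sigma> \<longleftrightarrow>
     small_sized TYPE('u) (syms \<Sigma>) \<and>
     (\<forall>\<sigma>\<in>syms \<Sigma>. set (ins \<Sigma> \<sigma>) \<subseteq> S \<and> out \<Sigma> \<sigma> \<in> S \<and> par \<Sigma> \<sigma> \<in> Ob C)"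

(* the object P \<times> (A_{S_1} \<times> ... \<times> A_{S_n}) and the morphism 1_P \<times> (f_{S_1} \<times> ... \<times> f_{S_n}) *)
definition dom_Ob ::
    "('u::set_universe, 'v) concrete \<Rightarrow> 'v \<Rightarrow> 's list \<Rightarrow> ('s \<Rightarrow> 'v) \<Rightarrow> 'v" where
  "dom_Ob C P ss A = prods C [P, prods C (map A ss)]"

definition dom_map ::
    "('u::set_universe, 'v) concrete \<Rightarrow> 'v \<Rightarrow> 's list \<Rightarrow> ('s \<Rightarrow> 'v) \<Rightarrow> ('s \<Rightarrow> 'u \<Rightarrow> 'u) \<Rightarrow> 'u \<Rightarrow> 'u" where
  "dom_map C P ss A f =
     prods_map C [P, prods C (map A ss)] [ident C P, prods_map C (map A ss) (map f ss)]"

record ('u, 'v, 'f, 's) algebra =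
  car :: "'s \<Rightarrow> 'v"
  opn :: "'f \<Rightarrow> 'u \<Rightarrow> 'u"

definition Alg ::
    "('u::set_universe, 'v) concrete \<Rightarrow> 's set \<Rightarrow> ('f, 's, 'v) enriched_signature
       \<Rightarrow> ('u, 'v, 'f, 's) algebra set" where
  "Alg C S \<Sigma> = {A. car A \<in> pow_Ob C S \<and>
     opn A \<in> (\<Pi>\<^sub>E \<sigma>\<in>syms \<Sigma>. Hom C (dom_Ob C (par \<Sigma> \<sigma>) (ins \<Sigma> \<sigma>) (car A)) (car A (out \<Sigma> \<sigma>)))}"

definition alg_Hom ::
    "('u::set_universe, 'v) concrete \<Rightarrow> 's set \<Rightarrow> ('f, 's, 'v) enriched_signature
       \<Rightarrow> ('u, 'v, 'f, 's) algebra \<Rightarrow> ('u, 'v, 'f, 's) algebra \<Rightarrow> ('s \<Rightarrow> 'u \<Rightarrow> 'u) set" where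
  "alg_Hom C S \<Sigma> A B = {f \<in> pow_Hom C S (car A) (car B). \<forall>\<sigma>\<in>syms \<Sigma>.
     (let P = par \<Sigma> \<sigma>; ss = ins \<Sigma> \<sigma>; D = Und C (dom_Ob C P ss (car A)) in
      compose D (f (out \<Sigma> \<sigma>)) (opn A \<sigma>) = compose D (opn B \<sigma>) (dom_map C P ss (car A) f))}"

(* For a full subcategory of the category of algebras, given by its class K of objects:
   A together with eta is a universal arrow from X to the forgetful functor on K. *)
definition free_on ::
    "('u::set_universe, 'v) concrete \<Rightarrow> 's set \<Rightarrow> ('f, 's, 'v) enriched_signature
       \<Rightarrow> ('u, 'v, 'f, 's) algebra set \<Rightarrow> ('s \<Rightarrow> 'v)
       \<Rightarrow> ('u, 'v, 'f, 's) algebra \<Rightarrow> ('s \<Rightarrow> 'u \<Rightarrow> 'u) \<Rightarrow> bool" where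
  "free_on C S \<Sigma> K X A \<eta> \<longleftrightarrow>
     A \<in> K \<and> \<eta> \<in> pow_Hom C S X (car A) \<and>
     (\<forall>B\<in>K. \<forall>f\<in>pow_Hom C S X (car B). \<exists>!h. h \<in> alg_Hom C S \<Sigma> A B \<and> pow_comp C S X h \<eta> = f)"

(* F, with unit eta, is left adjoint to the forgetful functor on K *)
definition left_adjoint ::
    "('u::set_universe, 'v) concrete \<Rightarrow> 's set \<Rightarrow> ('f, 's, 'v) enriched_signature
       \<Rightarrow> ('u, 'v, 'f, 's) algebra set \<Rightarrow> (('s \<Rightarrow> 'v) \<Rightarrow> ('u, 'v, 'f, 's) algebra)
       \<Rightarrow> (('s \<Rightarrow> 'v) \<Rightarrow> 's \<Rightarrow> 'u \<Rightarrow> 'u) \<Rightarrow> bool" where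
  "left_adjoint C S \<Sigma> K F \<eta> \<longleftrightarrow> (\<forall>X\<in>pow_Ob C S. free_on C S \<Sigma> K X (F X) (\<eta> X))"


section \<open>Enriched equational theories\<close>

record ('u, 'v, 'f, 's) operation =
  op_ins :: "'s list"
  op_out :: 's
  op_par :: 'v
  component :: "('u, 'v, 'f, 's) algebra \<Rightarrow> 'u \<Rightarrow> 'u"

definition algebraic_operation ::
    "('u::set_universe, 'v) concrete \<Rightarrow> 's set \<Rightarrow> ('f, 's, 'v) enriched_signature
       \<Rightarrow> ('u, 'v, 'f, 's) operation \<Rightarrow> bool" where
  "algebraic_operation C S \<Sigma> \<omega> \<longleftrightarrow>
     set (op_ins \<omega>) \<subseteq> S \<and> op_out \<omega> \<in> S \<and> op_par \<omega> \<in> Ob C \<and>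
     (let D = (\<lambda>A. dom_Ob C (op_par \<omega>) (op_ins \<omega>) (car A)) in
      (\<forall>A\<in>Alg C S \<Sigma>. component \<omega> A \<in> Hom C (D A) (car A (op_out \<omega>))) \<and>
      (\<forall>A\<in>Alg C S \<Sigma>. \<forall>B\<in>Alg C S \<Sigma>. \<forall>f\<in>alg_Hom C S \<Sigma> A B.
         compose (Und C (D A)) (f (op_out \<omega>)) (component \<omega> A) =
         compose (Und C (D A)) (component \<omega> B)
           (dom_map C (op_par \<omega>) (op_ins \<omega>) (car A) f)))"

type_synonym ('u, 'v, 'f, 's) equation =
  "('u, 'v, 'f, 's) operation \<times> ('u, 'v, 'f, 's) operation"

definition algebraic_equation ::
    "('u::set_universe, 'v) concrete \<Rightarrow> 's set \<Rightarrow> ('f, 's, 'v) enriched_signature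
       \<Rightarrow> ('u, 'v, 'f, 's) equation \<Rightarrow> bool" where
  "algebraic_equation C S \<Sigma> = (\<lambda>(\<omega>, \<nu>).
     algebraic_operation C S \<Sigma> \<omega> \<and> algebraic_operation C S \<Sigma> \<nu> \<and>
     op_ins \<omega> = op_ins \<nu> \<and> op_out \<omega> = op_out \<nu> \<and> op_par \<omega> = op_par \<nu>)"

definition equational_theory ::
    "('u::set_universe, 'v) concrete \<Rightarrow> 's set \<Rightarrow> ('f, 's, 'v) enriched_signature
       \<Rightarrow> ('u, 'v, 'f, 's) equation set \<Rightarrow> bool" where
  "equational_theory C S \<Sigma> \<E> \<longleftrightarrow>
     is_enriched_signature C S \<Sigma> \<and> (\<forall>e\<in>\<E>. algebraic_equation C S \<Sigma> e)"

definition TAlg ::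
    "('u::set_universe, 'v) concrete \<Rightarrow> 's set \<Rightarrow> ('f, 's, 'v) enriched_signature
       \<Rightarrow> ('u, 'v, 'f, 's) equation set \<Rightarrow> ('u, 'v, 'f, 's) algebra set" where
  "TAlg C S \<Sigma> \<E> = {A \<in> Alg C S \<Sigma>. \<forall>(\<omega>, \<nu>)\<in>\<E>. component \<omega> A = component \<nu> A}"


section \<open>Classical syntax\<close>

(* A variable is a pair of an index and its sort; a context is a list of distinct variables. *)
type_synonym 's var = "nat \<times> 's"

datatype ('f, 's) trm = Var "'s var" | App 'f "('f, 's) trm list"

inductive wt :: "('f, 's) signature \<Rightarrow> 's var list \<Rightarrow> ('f, 's) trm \<Rightarrow> 's \<Rightarrow> bool"
  for \<Gamma> :: "('f, 's) signature" and vs :: "'s var list" where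
    wt_Var: "x \<in> set vs \<Longrightarrow> wt \<Gamma> vs (Var x) (snd x)"
  | wt_App: "f \<in> syms \<Gamma> \<Longrightarrow> list_all2 (wt \<Gamma> vs) ts (ins \<Gamma> f) \<Longrightarrow> wt \<Gamma> vs (App f ts) (out \<Gamma> f)"

record ('f, 's, 'c) classical_algebra =
  ccar :: "'s \<Rightarrow> 'c set"
  copn :: "'f \<Rightarrow> 'c list \<Rightarrow> 'c"

(* interpretation of a term in context vs at the argument tuple xs *)
primrec eval ::
    "('f, 's, 'c) classical_algebra \<Rightarrow> 's var list \<Rightarrow> 'c list \<Rightarrow> ('f, 's) trm \<Rightarrow> 'c" where
  "eval D vs xs (Var x) = the (map_of (zip vs xs) x)"
| "eval D vs xs (App f ts) = copn D f (map (eval D vs xs) ts)"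

definition term_algebra ::
    "('f, 's) signature \<Rightarrow> 's var list \<Rightarrow> ('f, 's, ('f, 's) trm) classical_algebra" where
  "term_algebra \<Gamma> vs = \<lparr>ccar = (\<lambda>s. {t. wt \<Gamma> vs t s}), copn = App\<rparr>"

definition und_sig ::
    "('u, 'v) concrete \<Rightarrow> ('f, 's, 'v) enriched_signature \<Rightarrow> ('f \<times> 'u, 's) signature" where
  "und_sig C \<Sigma> = \<lparr>syms = (SIGMA \<sigma>:syms \<Sigma>. Und C (par \<Sigma> \<sigma>)),
     ins = (\<lambda>(\<sigma>, p). ins \<Sigma> \<sigma>), out = (\<lambda>(\<sigma>, p). out \<Sigma> \<sigma>)\<rparr>"

definition und_alg ::
    "('u::set_universe, 'v) concrete \<Rightarrow> ('u, 'v, 'f, 's) algebra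
       \<Rightarrow> ('f \<times> 'u, 's, 'u) classical_algebra" where
  "und_alg C A = \<lparr>ccar = (\<lambda>s. Und C (car A s)),
     copn = (\<lambda>(\<sigma>, p) xs. opn A \<sigma> (tuple [p, tuple xs]))\<rparr>"


section \<open>The underlying classical equations\<close>

definition indisc_alg ::
    "('u::set_universe, 'v) concrete \<Rightarrow> 's set \<Rightarrow> ('f, 's, 'v) enriched_signature
       \<Rightarrow> ('f \<times> 'u, 's, 'u) classical_algebra \<Rightarrow> ('u, 'v, 'f, 's) algebra" where
  "indisc_alg C S \<Sigma> D = (let A = (\<lambda>s\<in>S. Indisc C (ccar D s)) in
     \<lparr>car = A,
      opn = (\<lambda>\<sigma>\<in>syms \<Sigma>. \<lambda>z\<in>Und C (dom_Ob C (par \<Sigma> \<sigma>) (ins \<Sigma> \<sigma>) A).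
        copn D (\<sigma>, untuple z ! 0) (untuple (untuple z ! 1)))\<rparr>)"

(* Terms are not elements of the universe.  The set of all terms in a context is small, so it
   has a bijective copy, along the chosen injection enc, in the universe. *)
definition terms :: "('f, 's) signature \<Rightarrow> 's var list \<Rightarrow> ('f, 's) trm set" where
  "terms \<Gamma> vs = {t. \<exists>s. wt \<Gamma> vs t s}"

definition enc :: "('f, 's) signature \<Rightarrow> 's var list \<Rightarrow> ('f, 's) trm \<Rightarrow> 'u::set_universe" where
  "enc \<Gamma> vs = (SOME e. inj_on e (terms \<Gamma> vs) \<and> small (e ` terms \<Gamma> vs))"

definition dec :: "('f, 's) signature \<Rightarrow> 's var list \<Rightarrow> 'u::set_universe \<Rightarrow> ('f, 's) trm" where
  "dec \<Gamma> vs = inv_into (terms \<Gamma> vs) (enc \<Gamma> vs)"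

definition coded_term_algebra ::
    "('f, 's) signature \<Rightarrow> 's var list \<Rightarrow> ('f, 's, 'u::set_universe) classical_algebra" where
  "coded_term_algebra \<Gamma> vs =
     \<lparr>ccar = (\<lambda>s. enc \<Gamma> vs ` ccar (term_algebra \<Gamma> vs) s),
      copn = (\<lambda>f xs. enc \<Gamma> vs (copn (term_algebra \<Gamma> vs) f (map (dec \<Gamma> vs) xs)))\<rparr>"

definition op_term ::
    "('u::set_universe, 'v) concrete \<Rightarrow> 's set \<Rightarrow> ('f, 's, 'v) enriched_signature
       \<Rightarrow> ('u, 'v, 'f, 's) operation \<Rightarrow> 'u \<Rightarrow> 's var list \<Rightarrow> ('f \<times> 'u, 's) trm" where
  "op_term C S \<Sigma> \<omega> p vs = (let \<Gamma> = und_sig C \<Sigma> in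
     dec \<Gamma> vs (component \<omega> (indisc_alg C S \<Sigma> (coded_term_algebra \<Gamma> vs))
       (tuple [p, tuple (map (\<lambda>x. enc \<Gamma> vs (Var x)) vs)])))"

(* (vs, s, t, S) stands for the equation s = t of sort S in context vs *)
type_synonym ('f, 's) syntactic_equation = "'s var list \<times> ('f, 's) trm \<times> ('f, 's) trm \<times> 's"

definition und_eqs ::
    "('u::set_universe, 'v) concrete \<Rightarrow> 's set \<Rightarrow> ('f, 's, 'v) enriched_signature
       \<Rightarrow> ('u, 'v, 'f, 's) equation set \<Rightarrow> ('f \<times> 'u, 's) syntactic_equation set" where
  "und_eqs C S \<Sigma> \<E> =
     {(vs, op_term C S \<Sigma> \<omega> p vs, op_term C S \<Sigma> \<nu> p vs, op_out \<omega>) | \<omega> \<nu> p vs.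
        (\<omega>, \<nu>) \<in> \<E> \<and> p \<in> Und C (op_par \<omega>) \<and> distinct vs \<and> map snd vs = op_ins \<omega>}"


section \<open>Congruences and quotient algebras\<close>

definition congruence ::
    "('u::set_universe, 'v) concrete \<Rightarrow> 's set \<Rightarrow> ('f, 's, 'v) enriched_signature
       \<Rightarrow> ('u, 'v, 'f, 's) algebra \<Rightarrow> ('s \<Rightarrow> 'u rel) \<Rightarrow> bool" where
  "congruence C S \<Sigma> A R \<longleftrightarrow>
     (\<forall>s\<in>S. equiv (Und C (car A s)) (R s)) \<and>
     (\<forall>\<sigma>\<in>syms \<Sigma>. \<forall>p\<in>Und C (par \<Sigma> \<sigma>). \<forall>as bs.
        length as = length (ins \<Sigma> \<sigma>) \<longrightarrow> length bs = length (ins \<Sigma> \<sigma>) \<longrightarrow>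
        (\<forall>i<length (ins \<Sigma> \<sigma>). (as ! i, bs ! i) \<in> R (ins \<Sigma> \<sigma> ! i)) \<longrightarrow>
        (opn A \<sigma> (tuple [p, tuple as]), opn A \<sigma> (tuple [p, tuple bs])) \<in> R (out \<Sigma> \<sigma>))"

definition contains_eqs ::
    "('u::set_universe, 'v) concrete \<Rightarrow> 's set \<Rightarrow> ('f, 's, 'v) enriched_signature
       \<Rightarrow> ('u, 'v, 'f, 's) equation set \<Rightarrow> ('u, 'v, 'f, 's) algebra \<Rightarrow> ('s \<Rightarrow> 'u rel) \<Rightarrow> bool" where
  "contains_eqs C S \<Sigma> \<E> A R \<longleftrightarrow>
     (\<forall>(vs, t, t', s)\<in>und_eqs C S \<Sigma> \<E>. \<forall>as\<in>listset (map (\<lambda>x. Und C (car A (snd x))) vs).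
        (eval (und_alg C A) vs as t, eval (und_alg C A) vs as t') \<in> R s)"

(* the smallest such congruence, as the intersection of all of them *)
definition gen_congruence ::
    "('u::set_universe, 'v) concrete \<Rightarrow> 's set \<Rightarrow> ('f, 's, 'v) enriched_signature
       \<Rightarrow> ('u, 'v, 'f, 's) equation set \<Rightarrow> ('u, 'v, 'f, 's) algebra \<Rightarrow> 's \<Rightarrow> 'u rel" where
  "gen_congruence C S \<Sigma> \<E> A s =
     \<Inter> {R s | R. congruence C S \<Sigma> A R \<and> contains_eqs C S \<Sigma> \<E> A R}"

(* Equivalence classes are not elements of the universe; each class is coded by a chosen
   element of it, which is injective on classes. *)
definition class_code :: "'u set \<Rightarrow> 'u" where
  "class_code K = (SOME x. x \<in> K)"

definition quot_map ::
    "('u, 'v) concrete \<Rightarrow> 's set \<Rightarrow> ('u, 'v, 'f, 's) algebra \<Rightarrow> ('s \<Rightarrow> 'u rel) \<Rightarrow> 's \<Rightarrow> 'u \<Rightarrow> 'u" where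
  "quot_map C S A R = (\<lambda>s\<in>S. \<lambda>a\<in>Und C (car A s). class_code (R s `` {a}))"

definition quot_alg ::
    "('u::set_universe, 'v) concrete \<Rightarrow> 's set \<Rightarrow> ('f, 's, 'v) enriched_signature
       \<Rightarrow> ('u, 'v, 'f, 's) algebra \<Rightarrow> ('s \<Rightarrow> 'u rel) \<Rightarrow> ('u, 'v, 'f, 's) algebra" where
  "quot_alg C S \<Sigma> A R = (let q = quot_map C S A R;
       Q = (\<lambda>s\<in>S. final_structure C (class_code ` (Und C (car A s) // R s)) {(car A s, q s)}) in
     \<lparr>car = Q,
      opn = (\<lambda>\<sigma>\<in>syms \<Sigma>. \<lambda>z\<in>Und C (dom_Ob C (par \<Sigma> \<sigma>) (ins \<Sigma> \<sigma>) Q).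
        THE c. \<exists>p\<in>Und C (par \<Sigma> \<sigma>). \<exists>as\<in>listset (map (\<lambda>s. Und C (car A s)) (ins \<Sigma> \<sigma>)).
          z = tuple [p, tuple (map2 q (ins \<Sigma> \<sigma>) as)] \<and>
          c = q (out \<Sigma> \<sigma>) (opn A \<sigma> (tuple [p, tuple as])))\<rparr>)"

end

(* Quotient maps are final surjections.  Cartesian closedness makes them stable under finite
   products, so the operations of an algebra descend to admissible operations on the quotient by a
   congruence.  Naturality along the identity into the indiscrete algebra, and along evaluation out
   of the indiscrete term algebra, shows that an algebraic operation acts on every algebra by its
   term; hence a congruence contains the equations of |E| iff it identifies the two sides of every
   equation of the theory.  The quotient of the free algebra by the generated congruence therefore
   satisfies the equations, and a morphism from the free algebra to an algebra of the theory
   factors through it, as its kernel is a congruence containing the equations. *)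
theory Submission
  imports Defs
begin

section \<open>Small sets\<close>

text \<open>The detour through indiscrete algebras resolves a clash of structures. Terms must carry
  a structure for which all operations, including their dependence on the parameter, are admissible.
  The indiscrete one achieves this, since every function into it is admissible, but then an
  evaluation out of it is only guaranteed to be admissible if its codomain is indiscrete too. So
  \<open>A\<close> is replaced by its indiscrete copy, into which the identity is admissible for the
  same reason, and components are compared there. Cartesian closedness enters because in a general
  topological category a product of quotient maps is a surjection that may fail to be final. Here
  the product with a fixed object is a left adjoint, so factors can be replaced by their quotients
  one at a time, with the parameter and the other factors as the fixed object. Terms and equivalence
  classes live outside \<open>'u\<close>: the sets of terms must be shown to be small before they
  can be coded, and classes are represented by their members.\<close>

lemma untuple_tuple [simp]: "untuple (tuple xs) = xs"
  unfolding untuple_def by (simp add: inj_tuple)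

lemma tuple_eq_iff [simp]: "tuple xs = tuple ys \<longleftrightarrow> xs = ys"
  using inj_tuple by (auto dest: injD)

lemma listset_iff_list_all2: "xs \<in> listset As \<longleftrightarrow> list_all2 (\<in>) xs As"
  by (induction As arbitrary: xs) (auto simp: set_Cons_def list_all2_Cons2)

text \<open>An infinite small set contains a copy of the naturals, and \<open>g\<close> factors
  through that copy.\<close>

lemma small_range_nat: "small (range (g :: nat \<Rightarrow> 'u::set_universe))"
proof -
  obtain A :: "'u set" where "small A" "infinite A"
    using small_infinite by blast
  then obtain f :: "nat \<Rightarrow> 'u" where f: "inj f" "range f \<subseteq> A"
    using infinite_countable_subset by blast
  then have "small ((\<lambda>x. g (inv f x)) ` range f)"
    using \<open>small A\<close> small_subset small_image by blast
  then show ?thesis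
    using f by (simp add: image_image)
qed

text \<open>\<open>small_UN\<close> takes its index set inside \<open>'u\<close>, so the union is
  reindexed along an injection of the naturals into \<open>'u\<close>.\<close>

lemma small_UN_nat:
  assumes "\<And>n::nat. small (F n :: 'u::set_universe set)"
  shows "small (\<Union>n. F n)"
proof -
  obtain A :: "'u set" where "infinite A"
    using small_infinite by blast
  then obtain f :: "nat \<Rightarrow> 'u" where f: "inj f"
    using infinite_countable_subset by blast
  have "small (\<Union>i\<in>range f. F (inv f i))"
    using assms by (intro small_UN small_range_nat)
  then show ?thesis
    using f by simp
qed

lemma small_finite:
  assumes "finite (A :: 'u::set_universe set)"
  shows "small A"
proof -
  obtain n :: nat and f where "A = f ` {i. i < n}"
    using finite_imp_nat_seg_image_inj_on[OF assms] by blast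
  then have "A \<subseteq> range f"
    by auto
  then show ?thesis
    using small_range_nat small_subset by blast
qed

lemma small_Un:
  assumes "small A" "small (B :: 'u::set_universe set)"
  shows "small (A \<union> B)"
proof -
  have "small (\<Union>n. if n = (0::nat) then A else B)"
    using assms by (intro small_UN_nat) auto
  moreover have "A \<union> B \<subseteq> (\<Union>n. if n = (0::nat) then A else B)"
    by (auto split: if_splits)
  ultimately show ?thesis
    by (rule small_subset)
qed

lemma small_tuple_listset:
  assumes "\<And>A. A \<in> set As \<Longrightarrow> small (A :: 'u::set_universe set)"
  shows "small (tuple ` listset As)"
  using assms
proof (induction As)
  case Nil
  then show ?case by (simp add: small_finite)
next
  case (Cons A As)
  have "tuple ` listset (A # As) =
      (\<Union>a\<in>A. (\<lambda>z. tuple (a # untuple z)) ` tuple ` listset As)"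
    by (auto simp: set_Cons_def image_iff)
  then show ?case
    using Cons by (auto intro!: small_UN small_image)
qed

text \<open>Lists of a fixed length form a finite product; the union runs over the countably many
  lengths.\<close>

lemma small_tuple_lists:
  assumes "small (A :: 'u::set_universe set)"
  shows "small (tuple ` lists A)"
proof -
  have "tuple ` lists A \<subseteq> (\<Union>n. tuple ` listset (replicate n A))"
  proof (rule image_subsetI)
    fix xs assume "xs \<in> lists A"
    then have "xs \<in> listset (replicate (length xs) A)"
      by (auto simp: listset_iff_list_all2 list_all2_conv_all_nth)
    then show "tuple xs \<in> (\<Union>n. tuple ` listset (replicate n A))"
      by blast
  qed
  moreover have "small (\<Union>n. tuple ` listset (replicate n A))"
    using assms by (intro small_UN_nat small_tuple_listset) (simp add: set_replicate_conv_if split: if_splits)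
  ultimately show ?thesis
    by (rule small_subset[rotated])
qed

lemma small_sized_Sigma:
  assumes "small_sized TYPE('u::set_universe) A" "\<And>x. x \<in> A \<Longrightarrow> small (B x :: 'u set)"
  shows "small_sized TYPE('u) (Sigma A B)"
proof -
  obtain f :: "'a \<Rightarrow> 'u" where f: "inj_on f A" "small (f ` A)"
    using assms(1) unfolding small_sized_def by blast
  let ?g = "\<lambda>(x, y). tuple [f x, y]"
  have "inj_on ?g (Sigma A B)"
    using f(1) by (auto simp: inj_on_def)
  \<comment> \<open>Reindexing by the image of \<open>A\<close> under \<open>f\<close>, through
    \<open>inv_into\<close>, puts the index set of the union inside \<open>'u\<close>, as
    \<open>small_UN\<close> requires.\<close>
  moreover have "?g ` Sigma A B = (\<Union>a\<in>f ` A. (\<lambda>y. tuple [a, y]) ` B (inv_into A f a))"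
    using f(1) by force
  moreover have "small (\<Union>a\<in>f ` A. (\<lambda>y. tuple [a, y]) ` B (inv_into A f a))"
    using assms(2) by (intro small_UN small_image f(2)) (metis inv_into_into)
  ultimately show ?thesis
    unfolding small_sized_def by metis
qed


section \<open>Terms\<close>

(* Variables and applications are told apart by the length of the tuple. *)
primrec term_code :: "('f \<Rightarrow> 'u) \<Rightarrow> ('s var \<Rightarrow> 'u) \<Rightarrow> ('f, 's) trm \<Rightarrow> 'u::set_universe" where
  "term_code g v (Var x) = tuple [v x]"
| "term_code g v (App f ts) = tuple [g f, tuple (map (term_code g v) ts)]"

inductive_cases wt_AppE: "wt \<Gamma> vs (App f ts) s"
inductive_cases wt_VarE: "wt \<Gamma> vs (Var x) s"

lemma wt_terms: "wt \<Gamma> vs t s \<Longrightarrow> t \<in> terms \<Gamma> vs"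
  unfolding terms_def by blast

lemma term_args_terms:
  assumes "App f ts \<in> terms \<Gamma> vs"
  shows "f \<in> syms \<Gamma>" "set ts \<subseteq> terms \<Gamma> vs"
  using assms unfolding terms_def
  by (force elim!: wt_AppE simp: list_all2_conv_all_nth in_set_conv_nth)+

text \<open>Induction on the first term. Membership in \<open>terms\<close> confines symbols and
  variables to the sets on which \<open>g\<close> and \<open>v\<close> are injective, and passes to
  arguments by \<open>term_args_terms\<close>.\<close>

lemma inj_on_term_code:
  assumes "inj_on g (syms \<Gamma>)" "inj_on v (set vs)"
  shows "inj_on (term_code g v) (terms \<Gamma> vs)"
proof -
  have "t \<in> terms \<Gamma> vs \<Longrightarrow> u \<in> terms \<Gamma> vs \<Longrightarrow> term_code g v t = term_code g v u \<Longrightarrow> t = u" for t u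
  proof (induction t arbitrary: u)
    case (Var x)
    then show ?case
      using assms(2) by (cases u) (auto simp: terms_def inj_on_def elim!: wt_VarE)
  next
    case (App f ts)
    then obtain h us where u: "u = App h us"
      by (cases u) auto
    have eq: "g f = g h" "map (term_code g v) ts = map (term_code g v) us"
      using App.prems(3) u by auto
    have "f = h"
      using eq(1) assms(1) term_args_terms App.prems(1,2) u by (metis inj_onD)
    moreover have "ts = us"
    proof (rule nth_equalityI)
      show "length ts = length us"
        using eq(2) map_eq_imp_length_eq by blast
      then show "ts ! i = us ! i" if "i < length ts" for i
        using that eq(2) App.IH[of "ts ! i" "us ! i"] App.prems(1,2) u term_args_terms(2)
        by (metis nth_map nth_mem subsetD)
    qed
    ultimately show ?case
      using u by simp
  qed
  then show ?thesis
    unfolding inj_on_def by blast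
qed

text \<open>The codes are exhausted by countably many stages, each obtained from its predecessor by
  small unions and images.\<close>

lemma small_sized_terms:
  assumes "small_sized TYPE('u::set_universe) (syms (\<Gamma> :: ('f, 's) signature))"
  shows "small_sized TYPE('u) (terms \<Gamma> vs)"
proof -
  obtain g :: "'f \<Rightarrow> 'u" where g: "inj_on g (syms \<Gamma>)" "small (g ` syms \<Gamma>)"
    using assms unfolding small_sized_def by blast
  \<comment> \<open>A finite context injects into the naturals, and these embed into an infinite
    subset of \<open>'u\<close>.\<close>
  obtain A :: "'u set" where "infinite A"
    using small_infinite by blast
  then obtain i :: "nat \<Rightarrow> 'u" where "inj i"
    using infinite_countable_subset by blast
  moreover obtain j :: "'s var \<Rightarrow> nat" where "inj_on j (set vs)"
    using finite_imp_inj_to_nat_seg[of "set vs"] by auto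
  ultimately have "inj_on (i \<circ> j) (set vs)"
    by (meson comp_inj_on inj_on_subset subset_UNIV)
  then obtain v :: "'s var \<Rightarrow> 'u" where v: "inj_on v (set vs)"
    by blast
  \<comment> \<open>Stage \<open>n\<close> is to contain the codes of all terms of size below
    \<open>n\<close>. Arities and sorts are disregarded: an upper bound is enough, as subsets of
    small sets are small.\<close>
  define T :: "nat \<Rightarrow> 'u set" where
    "T = rec_nat {} (\<lambda>_ B. (\<lambda>x. tuple [v x]) ` set vs \<union>
      (\<Union>a\<in>g ` syms \<Gamma>. (\<lambda>l. tuple [a, l]) ` tuple ` lists B))"
  have T0: "T 0 = {}" and TSuc: "T (Suc n) = (\<lambda>x. tuple [v x]) ` set vs \<union>
      (\<Union>a\<in>g ` syms \<Gamma>. (\<lambda>l. tuple [a, l]) ` tuple ` lists (T n))" for n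
    by (simp_all add: T_def)
  have "small (T n)" for n
  proof (induction n)
    case 0
    then show ?case by (simp add: T0 small_finite)
  next
    case (Suc n)
    then show ?case
      unfolding TSuc
      by (intro small_Un small_UN small_image[OF small_tuple_lists] g(2))
        (auto intro: small_finite)
  qed
  then have "small (\<Union>n. T n)"
    by (rule small_UN_nat)
  \<comment> \<open>With the strict bound the induction starts vacuously at the empty stage
    \<open>T 0\<close>.\<close>
  moreover have mem: "t \<in> terms \<Gamma> vs \<Longrightarrow> size t < n \<Longrightarrow> term_code g v t \<in> T n" for t n
  proof (induction n arbitrary: t)
    case 0
    then show ?case by simp
  next
    case (Suc n)
    show ?case
    proof (cases t)
      case (Var x)
      then show ?thesis
        using Suc.prems(1) by (auto simp: TSuc terms_def elim!: wt_VarE)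
    next
      case (App f ts)
      have "term_code g v u \<in> T n" if "u \<in> set ts" for u
      proof (rule Suc.IH)
        show "u \<in> terms \<Gamma> vs"
          using Suc.prems(1) App that term_args_terms(2) by (metis subsetD)
        show "size u < n"
          using Suc.prems(2) App that size_list_estimation'[OF that, of "size u" size] by simp
      qed
      then have "tuple (map (term_code g v) ts) \<in> tuple ` lists (T n)"
        by (intro imageI) (auto simp: in_lists_conv_set)
      moreover have "g f \<in> g ` syms \<Gamma>"
        using Suc.prems(1) App term_args_terms(1) by (metis imageI)
      ultimately show ?thesis
        unfolding TSuc App by (intro UnI2 UN_I[of "g f"]) auto
    qed
  qed
  have "term_code g v ` terms \<Gamma> vs \<subseteq> (\<Union>n. T n)"
    using mem by blast
  ultimately have "small (term_code g v ` terms \<Gamma> vs)"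
    by (rule small_subset)
  then show ?thesis
    using inj_on_term_code[OF g(1) v] unfolding small_sized_def by blast
qed

text \<open>Without a witness the \<open>SOME\<close> in \<open>enc\<close> would say nothing; the
  smallness of the set of terms provides one.\<close>

lemma enc_terms:
  assumes "small_sized TYPE('u::set_universe) (syms \<Gamma>)"
  shows "inj_on (enc \<Gamma> vs :: _ \<Rightarrow> 'u) (terms \<Gamma> vs)" "small ((enc \<Gamma> vs :: _ \<Rightarrow> 'u) ` terms \<Gamma> vs)"
  using someI_ex[OF small_sized_terms[OF assms, of vs, unfolded small_sized_def]]
  unfolding enc_def by blast+


section \<open>Topological categories\<close>

(* f is only looked at on the underlying set of V, so that composites need no restriction. *)
definition adm :: "('u, 'v) concrete \<Rightarrow> 'v \<Rightarrow> 'v \<Rightarrow> ('u \<Rightarrow> 'u) \<Rightarrow> bool" where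
  "adm C V W f \<longleftrightarrow> V \<in> Ob C \<and> W \<in> Ob C \<and> restrict f (Und C V) \<in> Hom C V W"

lemma adm_Ob:
  assumes "adm C V W f"
  shows "V \<in> Ob C" "W \<in> Ob C"
  using assms by (simp_all add: adm_def)

lemma adm_restrict_Hom: "adm C V W f \<Longrightarrow> restrict f (Und C V) \<in> Hom C V W"
  by (simp add: adm_def)

lemma adm_cong:
  assumes "\<And>x. x \<in> Und C V \<Longrightarrow> f x = g x"
  shows "adm C V W f \<longleftrightarrow> adm C V W g"
proof -
  have "restrict f (Und C V) = restrict g (Und C V)"
    using assms by (intro restrict_ext)
  then show ?thesis
    by (simp add: adm_def)
qed

lemma adm_transfer:
  "adm C V W f \<Longrightarrow> (\<And>x. x \<in> Und C V \<Longrightarrow> f x = g x) \<Longrightarrow> adm C V W g"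
  using adm_cong by metis

context concrete_category
begin

lemma adm_in: "adm C V W f \<Longrightarrow> x \<in> Und C V \<Longrightarrow> f x \<in> Und C W"
  unfolding adm_def using Hom_funcset[of V W] by (fastforce simp: PiE_iff)

text \<open>Passes between the morphisms of the category and \<open>adm\<close>; extensionality pins
  down the values that \<open>adm\<close> ignores.\<close>

lemma Hom_iff_adm:
  assumes "V \<in> Ob C" "W \<in> Ob C"
  shows "f \<in> Hom C V W \<longleftrightarrow> adm C V W f \<and> f \<in> extensional (Und C V)"
  using assms Hom_funcset[OF assms]
  by (auto simp: adm_def PiE_iff extensional_restrict dest!: subsetD)

lemma adm_id: "V \<in> Ob C \<Longrightarrow> adm C V V (\<lambda>x. x)"
  using ident_Hom by (simp add: adm_def ident_def)

lemma adm_comp: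
  assumes "adm C V W f" "adm C W Z g"
  shows "adm C V Z (\<lambda>x. g (f x))"
proof -
  have "compose (Und C V) (restrict g (Und C W)) (restrict f (Und C V)) \<in> Hom C V Z"
    using assms compose_Hom unfolding adm_def by blast
  moreover have "compose (Und C V) (restrict g (Und C W)) (restrict f (Und C V)) =
      restrict (\<lambda>x. g (f x)) (Und C V)"
    using adm_in[OF assms(1)] by (auto simp: compose_def)
  ultimately show ?thesis
    using assms by (simp add: adm_def)
qed

lemma fib_le_iff_adm:
  assumes "V \<in> Ob C" "W \<in> Ob C"
  shows "fib_le C V W \<longleftrightarrow> adm C V W (\<lambda>x. x)"
  using assms by (simp add: fib_le_def adm_def ident_def)

end

section \<open>Lifts of sources and sinks; discrete and indiscrete objects\<close>

context topological_category
begin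

text \<open>The two admissible identities give inclusions of the underlying sets both ways, so both
  objects lie in one fibre, where amnesticity applies.\<close>

lemma fibre_antisym:
  assumes "adm C V W (\<lambda>x. x)" "adm C W V (\<lambda>x. x)"
  shows "V = W"
proof -
  have "Und C V = Und C W"
    using adm_in[OF assms(1)] adm_in[OF assms(2)] by blast
  then show ?thesis
    using amnestic assms fib_le_iff_adm adm_Ob[OF assms(1)]
    unfolding amnestic_def Fib_def by blast
qed

text \<open>Initiality with all side conditions moved inside the equivalence. Taking
  \<open>V\<close> for \<open>W\<close> and the identity for \<open>h\<close> then yields the
  admissibility of the legs.\<close>

lemma initial_lift_adm:
  assumes "small Y" and G: "\<And>V f. (V, f) \<in> G \<Longrightarrow> V \<in> Ob C \<and> f \<in> Y \<rightarrow> Und C V"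
  obtains V where "V \<in> Ob C" "Und C V = Y" "\<And>W h. adm C W V h \<longleftrightarrow>
    W \<in> Ob C \<and> h \<in> Und C W \<rightarrow> Y \<and> (\<forall>(V', f)\<in>G. adm C W V' (\<lambda>x. f (h x)))"
proof -
  \<comment> \<open>\<open>initial_lift\<close> expects extensional legs, so each leg is cut down to
    \<open>Y\<close>.\<close>
  let ?G = "(\<lambda>(V, f). (V, restrict f Y)) ` G"
  have "\<forall>(V, f)\<in>?G. V \<in> Ob C \<and> f \<in> Y \<rightarrow>\<^sub>E Und C V"
    using G by fastforce
  then obtain V where V: "V \<in> Fib C Y" "initial_source C V ?G"
    using initial_lift[OF assms(1)] by blast
  then have Ob: "V \<in> Ob C" and Und: "Und C V = Y"
    by (auto simp: Fib_def)
  have iff: "restrict h (Und C W) \<in> Hom C W V \<longleftrightarrow> (\<forall>(V', f)\<in>G. adm C W V' (\<lambda>x. f (h x)))"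
    if W: "W \<in> Ob C" and h: "h \<in> Und C W \<rightarrow> Y" for W h
  proof -
    have "restrict h (Und C W) \<in> Und C W \<rightarrow>\<^sub>E Und C V"
      using h Und by auto
    then have "restrict h (Und C W) \<in> Hom C W V \<longleftrightarrow>
        (\<forall>(V', f)\<in>?G. compose (Und C W) f (restrict h (Und C W)) \<in> Hom C W V')"
      using V(2) W unfolding initial_source_def by blast
    also have "\<dots> \<longleftrightarrow> (\<forall>(V', f)\<in>G. adm C W V' (\<lambda>x. f (h x)))"
    proof -
      have "compose (Und C W) (restrict f Y) (restrict h (Und C W)) \<in> Hom C W V' \<longleftrightarrow>
          adm C W V' (\<lambda>x. f (h x))" if "(V', f) \<in> G" for V' f
      proof -
        have "compose (Und C W) (restrict f Y) (restrict h (Und C W)) =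
            restrict (\<lambda>x. f (h x)) (Und C W)"
          using h unfolding compose_def by (intro restrict_ext) (auto simp: Pi_iff)
        then show ?thesis
          using G[OF that] W by (simp add: adm_def)
      qed
      then show ?thesis
        by (auto 0 3)
    qed
    finally show ?thesis .
  qed
  show thesis
  proof (rule that[OF Ob Und])
    show "adm C W V h \<longleftrightarrow>
      W \<in> Ob C \<and> h \<in> Und C W \<rightarrow> Y \<and> (\<forall>(V', f)\<in>G. adm C W V' (\<lambda>x. f (h x)))" for W h
      using iff[of W h] adm_in[of W V h] Ob Und unfolding adm_def by blast
  qed
qed

(* The final lift of a sink is the initial lift of the source of all functions out of Y
   whose composites with the sink are admissible. *)
lemma final_lift_adm:
  assumes "small Y" and G: "\<And>V g. (V, g) \<in> G \<Longrightarrow> V \<in> Ob C \<and> g \<in> Und C V \<rightarrow> Y"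
  obtains V where "V \<in> Ob C" "Und C V = Y" "\<And>W h. adm C V W h \<longleftrightarrow>
    W \<in> Ob C \<and> h \<in> Y \<rightarrow> Und C W \<and> (\<forall>(V', g)\<in>G. adm C V' W (\<lambda>x. h (g x)))"
proof -
  \<comment> \<open>This source may be large; initial lifts exist for arbitrary sets of
    legs.\<close>
  let ?H = "{(W, h). W \<in> Ob C \<and> h \<in> Y \<rightarrow> Und C W \<and> (\<forall>(V', g)\<in>G. adm C V' W (\<lambda>x. h (g x)))}"
  obtain V where V: "V \<in> Ob C" "Und C V = Y" and iff: "\<And>W h. adm C W V h \<longleftrightarrow>
    W \<in> Ob C \<and> h \<in> Und C W \<rightarrow> Y \<and> (\<forall>(V', f)\<in>?H. adm C W V' (\<lambda>x. f (h x)))"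
    using initial_lift_adm[OF assms(1), of ?H] by blast
  \<comment> \<open>By the choice of \<open>?H\<close>, a member of the sink followed by any leg of
    \<open>?H\<close> is admissible, so initiality applies to the member itself.\<close>
  have legs: "adm C V' V g" if "(V', g) \<in> G" for V' g
    using that G unfolding iff by auto
  have "adm C V W h \<longleftrightarrow>
    W \<in> Ob C \<and> h \<in> Y \<rightarrow> Und C W \<and> (\<forall>(V', g)\<in>G. adm C V' W (\<lambda>x. h (g x)))" (is "?l \<longleftrightarrow> ?r") for W h
  proof
    assume l: ?l
    have "adm C V' W (\<lambda>x. h (g x))" if "(V', g) \<in> G" for V' g
      using adm_comp[OF legs[OF that] l] .
    then show ?r
      using adm_in[OF l] V(2) adm_Ob(2)[OF l] by blast
  next
    assume ?r
    then have "(W, h) \<in> ?H"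
      by blast
    \<comment> \<open>Initiality at the identity of \<open>V\<close> returns the admissibility of
      all legs in \<open>?H\<close>.\<close>
    then show ?l
      using iff[of V "\<lambda>x. x"] adm_id[OF V(1)] by blast
  qed
  with V show thesis
    by (rule that)
qed

text \<open>Amnesticity makes the definite description meaningful: a final sink determines which
  functions out of the object are admissible, and between two objects with the same admissible
  functions out the identity is admissible both ways.\<close>

lemma final_structure_adm:
  assumes "small Y" "V \<in> Ob C" "q \<in> Und C V \<rightarrow>\<^sub>E Y"
  shows "final_structure C Y {(V, q)} \<in> Ob C" "Und C (final_structure C Y {(V, q)}) = Y"
    "adm C (final_structure C Y {(V, q)}) W h \<longleftrightarrow>
      W \<in> Ob C \<and> h \<in> Y \<rightarrow> Und C W \<and> adm C V W (\<lambda>x. h (q x))"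
proof -
  obtain Q where Q: "Q \<in> Ob C" "Und C Q = Y" and iff: "\<And>W h. adm C Q W h \<longleftrightarrow>
      W \<in> Ob C \<and> h \<in> Y \<rightarrow> Und C W \<and> adm C V W (\<lambda>x. h (q x))"
    using final_lift_adm[OF assms(1), of "{(V, q)}"] assms by auto
  have comp: "compose (Und C V) h q \<in> Hom C V W \<longleftrightarrow> adm C V W (\<lambda>x. h (q x))" if "W \<in> Ob C" for h W
    using that assms(2) by (simp add: adm_def compose_def)
  \<comment> \<open>\<open>final_sink\<close> speaks of extensional \<open>h\<close> only; this
    version covers all functions, in keeping with \<open>adm\<close>.\<close>
  have sink: "final_sink C Q' {(V, q)} \<longleftrightarrow> adm C V Q' q \<and>
      (\<forall>W\<in>Ob C. \<forall>h. adm C Q' W h \<longleftrightarrow> h \<in> Y \<rightarrow> Und C W \<and> adm C V W (\<lambda>x. h (q x)))"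
    if "Q' \<in> Fib C Y" for Q'
  proof -
    have Q': "Q' \<in> Ob C" "Und C Q' = Y"
      using that by (auto simp: Fib_def)
    have q: "q \<in> Hom C V Q' \<longleftrightarrow> adm C V Q' q"
      using Hom_iff_adm[OF assms(2) Q'(1)] assms(3) by (auto simp: PiE_iff)
    have "(\<forall>h\<in>Und C Q' \<rightarrow>\<^sub>E Und C W. h \<in> Hom C Q' W \<longleftrightarrow> adm C V W (\<lambda>x. h (q x))) \<longleftrightarrow>
      (\<forall>h. adm C Q' W h \<longleftrightarrow> h \<in> Y \<rightarrow> Und C W \<and> adm C V W (\<lambda>x. h (q x)))" (is "?l \<longleftrightarrow> ?r")
      if W: "W \<in> Ob C" for W
    proof
      assume l: ?l
      show ?r
      proof
        fix h
        have h: "adm C V W (\<lambda>x. restrict h Y (q x)) \<longleftrightarrow> adm C V W (\<lambda>x. h (q x))"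
          using assms(3) by (intro adm_cong) auto
        have "restrict h Y \<in> Hom C Q' W \<longleftrightarrow> adm C Q' W h"
          using Q' W by (simp add: adm_def)
        moreover have "h \<in> Y \<rightarrow> Und C W" if "adm C Q' W h"
          using adm_in[OF that] Q'(2) by blast
        moreover have "restrict h Y \<in> Hom C Q' W \<longleftrightarrow> adm C V W (\<lambda>x. h (q x))" if "h \<in> Y \<rightarrow> Und C W"
          using l[rule_format, of "restrict h Y"] that Q'(2) h by auto
        ultimately show "adm C Q' W h \<longleftrightarrow> h \<in> Y \<rightarrow> Und C W \<and> adm C V W (\<lambda>x. h (q x))"
          by blast
      qed
    next
      assume ?r
      then show ?l
        using Hom_iff_adm[OF Q'(1) W] Q'(2) by (auto simp: PiE_iff)
    qed
    then show ?thesis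
      unfolding final_sink_def using comp q Q'(2) by simp
  qed
  have "final_structure C Y {(V, q)} = Q"
    unfolding final_structure_def
  proof (rule the_equality)
    have "adm C V Q q"
      using adm_id[OF Q(1)] iff[of Q "\<lambda>x. x"] by blast
    moreover have "Q \<in> Fib C Y"
      using Q by (simp add: Fib_def)
    ultimately show *: "Q \<in> Fib C Y \<and> final_sink C Q {(V, q)}"
      using sink iff by blast
    fix Q' assume Q': "Q' \<in> Fib C Y \<and> final_sink C Q' {(V, q)}"
    have "adm C Q' W h \<longleftrightarrow> adm C Q W h" if "W \<in> Ob C" for W h
      using sink Q' * that by blast
    moreover have "Q' \<in> Ob C"
      using Q' by (simp add: Fib_def)
    ultimately show "Q' = Q"
      using fibre_antisym adm_id Q(1) by blast
  qed
  then show "final_structure C Y {(V, q)} \<in> Ob C" "Und C (final_structure C Y {(V, q)}) = Y"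
    "adm C (final_structure C Y {(V, q)}) W h \<longleftrightarrow>
      W \<in> Ob C \<and> h \<in> Y \<rightarrow> Und C W \<and> adm C V W (\<lambda>x. h (q x))"
    using Q iff by simp_all
qed

text \<open>The final lift of the empty sink. Its one-point instance is the domain of the
  generalized elements in \<open>exponential\<close>.\<close>

lemma discrete_object:
  assumes "small Y"
  obtains V where "V \<in> Ob C" "Und C V = Y"
    "\<And>W h. W \<in> Ob C \<Longrightarrow> h \<in> Y \<rightarrow> Und C W \<Longrightarrow> adm C V W h"
proof -
  obtain V where "V \<in> Ob C" "Und C V = Y"
    "\<And>W h. adm C V W h \<longleftrightarrow> W \<in> Ob C \<and> h \<in> Y \<rightarrow> Und C W \<and> (\<forall>(V', g)\<in>{}. adm C V' W (\<lambda>x. h (g x)))"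
    using final_lift_adm[OF assms, of "{}"] by blast
  then show thesis
    by (intro that) auto
qed

text \<open>The initial lift of the empty source admits every function into it, hence lies above its
  whole fibre; by amnesticity it is the greatest element.\<close>

lemma Indisc_adm:
  assumes "small Y"
  shows "Indisc C Y \<in> Ob C" "Und C (Indisc C Y) = Y"
    "W \<in> Ob C \<Longrightarrow> h \<in> Und C W \<rightarrow> Y \<Longrightarrow> adm C W (Indisc C Y) h"
proof -
  obtain V where V: "V \<in> Ob C" "Und C V = Y"
    and adm: "\<And>W h. adm C W V h \<longleftrightarrow> W \<in> Ob C \<and> h \<in> Und C W \<rightarrow> Y"
    using initial_lift_adm[OF assms, of "{}"] by auto
  have "Indisc C Y = V"
    unfolding Indisc_def
  proof (rule the_equality)
    show *: "V \<in> Fib C Y \<and> (\<forall>V'\<in>Fib C Y. fib_le C V' V)"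
      using V adm by (auto simp: Fib_def fib_le_iff_adm)
    show "V' = V" if "V' \<in> Fib C Y \<and> (\<forall>W\<in>Fib C Y. fib_le C W V')" for V'
      using that * amnestic unfolding amnestic_def by blast
  qed
  then show "Indisc C Y \<in> Ob C" "Und C (Indisc C Y) = Y"
    "W \<in> Ob C \<Longrightarrow> h \<in> Und C W \<rightarrow> Y \<Longrightarrow> adm C W (Indisc C Y) h"
    using V adm by simp_all
qed


section \<open>Finite products\<close>

text \<open>Products are equal here and not just isomorphic: both live on the same set of tuples,
  and a mediating function that commutes with the coordinates fixes every tuple.\<close>

lemma is_product_unique:
  assumes "is_product C Vs Q" "is_product C Vs Q'" "set Vs \<subseteq> Ob C"
  shows "Q = Q'"
proof -
  have "adm C Q Q' (\<lambda>x. x)" if Q: "is_product C Vs Q" and Q': "is_product C Vs Q'" for Q Q'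
  proof -
    have Und: "Q \<in> Ob C" "Q' \<in> Ob C" "Und C Q = tuple ` listset (map (Und C) Vs)"
        "Und C Q' = tuple ` listset (map (Und C) Vs)"
      using Q Q' by (auto simp: is_product_def Fib_def)
    have "\<forall>i<length Vs. map (proj C Q) [0..<length Vs] ! i \<in> Hom C Q (Vs ! i)"
      using Q by (auto simp: is_product_def)
    moreover have "length (map (proj C Q) [0..<length Vs]) = length Vs"
      by simp
    ultimately obtain h where h: "h \<in> Hom C Q Q'" "\<forall>i<length Vs. compose (Und C Q) (proj C Q' i) h =
        map (proj C Q) [0..<length Vs] ! i"
      using Q' Und(1) unfolding is_product_def by blast
    have hadm: "adm C Q Q' h"
      using h(1) Und Hom_iff_adm by blast
    have "h x = x" if x: "x \<in> Und C Q" for x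
    proof -
      have hx: "h x \<in> Und C Q'"
        using adm_in[OF hadm x] .
      obtain xs where xs: "x = tuple xs" "xs \<in> listset (map (Und C) Vs)"
        using x Und by auto
      obtain ys where ys: "h x = tuple ys" "ys \<in> listset (map (Und C) Vs)"
        using hx Und by auto
      have "xs ! i = ys ! i" if "i < length Vs" for i
        using fun_cong[OF h(2)[rule_format, OF that], of x] that x hx xs ys
        by (simp add: compose_def proj_def)
      then have "xs = ys"
        using xs(2) ys(2) by (simp add: listset_iff_list_all2 list_all2_conv_all_nth nth_equalityI)
      then show ?thesis
        using xs ys by simp
    qed
    then show ?thesis
      using hadm adm_cong[of C Q h "\<lambda>x. x" Q'] by blast
  qed
  with assms show ?thesis
    by (intro fibre_antisym) auto
qed

text \<open>The product is the initial lift of the coordinate functions on the cartesian product of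
  the underlying sets. This settles the \<open>THE\<close> in \<open>prods\<close> once and for
  all.\<close>

lemma prods_characterization:
  assumes "set Vs \<subseteq> Ob C"
  shows "prods C Vs \<in> Ob C \<and> Und C (prods C Vs) = tuple ` listset (map (Und C) Vs) \<and>
    (\<forall>W h. adm C W (prods C Vs) h \<longleftrightarrow> W \<in> Ob C \<and> h \<in> Und C W \<rightarrow> tuple ` listset (map (Und C) Vs) \<and>
      (\<forall>i<length Vs. adm C W (Vs ! i) (\<lambda>x. untuple (h x) ! i)))"
proof -
  define Y where "Y = tuple ` listset (map (Und C) Vs)"
  have Yi: "untuple y ! i \<in> Und C (Vs ! i)" "length (untuple y) = length Vs"
    if "y \<in> Y" "i < length Vs" for y i
    using that by (auto simp: Y_def listset_iff_list_all2 list_all2_conv_all_nth)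
  have "small Y"
    unfolding Y_def using assms small_Und by (intro small_tuple_listset) auto
  then obtain Q where Q: "Q \<in> Ob C" "Und C Q = Y" and iff: "\<And>W h. adm C W Q h \<longleftrightarrow>
    W \<in> Ob C \<and> h \<in> Und C W \<rightarrow> Y \<and>
    (\<forall>(V', f)\<in>(\<lambda>i. (Vs ! i, \<lambda>z. untuple z ! i)) ` {..<length Vs}. adm C W V' (\<lambda>x. f (h x)))"
  proof (rule initial_lift_adm)
    show "V \<in> Ob C \<and> f \<in> Y \<rightarrow> Und C V"
      if "(V, f) \<in> (\<lambda>i. (Vs ! i, \<lambda>z. untuple z ! i)) ` {..<length Vs}" for V f
      using that Yi assms by (auto simp: subset_iff)
  qed blast
  have iff: "adm C W Q h \<longleftrightarrow> W \<in> Ob C \<and> h \<in> Und C W \<rightarrow> Y \<and>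
      (\<forall>i<length Vs. adm C W (Vs ! i) (\<lambda>x. untuple (h x) ! i))" for W h
    unfolding iff by auto
  have proj: "adm C Q (Vs ! i) (\<lambda>x. untuple x ! i)" if "i < length Vs" for i
    using iff[of Q "\<lambda>x. x"] adm_id[OF Q(1)] that by blast
  have "is_product C Vs Q"
    unfolding is_product_def
  proof (intro conjI allI impI ballI)
    show "Q \<in> Fib C (tuple ` listset (map (Und C) Vs))"
      using Q by (simp add: Fib_def Y_def)
    show "proj C Q i \<in> Hom C Q (Vs ! i)" if "i < length Vs" for i
      using adm_restrict_Hom[OF proj[OF that]] by (simp add: proj_def)
  next
    fix W fs assume W: "W \<in> Ob C" and len: "length fs = length Vs"
      and fs: "\<forall>i<length Vs. fs ! i \<in> Hom C W (Vs ! i)"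
    let ?h = "\<lambda>x\<in>Und C W. tuple (map (\<lambda>f. f x) fs)"
    have fs_adm: "adm C W (Vs ! i) (fs ! i)" "fs ! i \<in> extensional (Und C W)" if "i < length Vs" for i
      using fs that Hom_iff_adm[OF W] assms by (meson nth_mem subsetD)+
    have "?h \<in> Und C W \<rightarrow> Y"
      using adm_in[OF fs_adm(1)] len
      by (force simp: Y_def listset_iff_list_all2 list_all2_conv_all_nth)
    moreover have "adm C W (Vs ! i) (\<lambda>x. untuple (?h x) ! i)" if "i < length Vs" for i
      using fs_adm(1)[OF that] that len adm_cong[of C W "fs ! i" "\<lambda>x. untuple (?h x) ! i"] by simp
    ultimately have h: "adm C W Q ?h"
      unfolding iff using W by blast
    show "\<exists>!h. h \<in> Hom C W Q \<and> (\<forall>i<length Vs. compose (Und C W) (proj C Q i) h = fs ! i)"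
    proof (intro ex1I[of _ ?h] conjI allI impI)
      show "?h \<in> Hom C W Q"
        using h Hom_iff_adm[OF W Q(1)] by simp
      show "compose (Und C W) (proj C Q i) ?h = fs ! i" if "i < length Vs" for i
        using fs_adm(2)[OF that] adm_in[OF h] that len
        by (auto simp: compose_def proj_def fun_eq_iff extensional_def)
    next
      fix k assume k: "k \<in> Hom C W Q \<and> (\<forall>i<length Vs. compose (Und C W) (proj C Q i) k = fs ! i)"
      have kadm: "adm C W Q k" "k \<in> extensional (Und C W)"
        using k Hom_iff_adm[OF W Q(1)] by auto
      show "k = ?h"
      proof (rule extensionalityI[OF kadm(2)])
        show "k x = ?h x" if x: "x \<in> Und C W" for x
        proof -
          have kx: "k x \<in> Und C Q"
            using adm_in[OF kadm(1) x] .
          then obtain ys where ys: "k x = tuple ys" "length ys = length Vs"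
            using Q(2) by (auto simp: Y_def listset_iff_list_all2 list_all2_conv_all_nth)
          have "ys ! i = (fs ! i) x" if "i < length Vs" for i
          proof -
            have "compose (Und C W) (proj C Q i) k x = (fs ! i) x"
              using k that by simp
            then show ?thesis
              using kx x ys by (simp add: compose_def proj_def)
          qed
          then have "ys = map (\<lambda>f. f x) fs"
            using ys(2) len by (intro nth_equalityI) auto
          then show ?thesis
            using ys x by simp
        qed
      qed simp
    qed
  qed
  then have "prods C Vs = Q"
    unfolding prods_def using is_product_unique assms by blast
  then show ?thesis
    using Q iff by (simp add: Y_def)
qed

lemma prods_Ob: "set Vs \<subseteq> Ob C \<Longrightarrow> prods C Vs \<in> Ob C"
  using prods_characterization by blast

lemma Und_prods: "set Vs \<subseteq> Ob C \<Longrightarrow> Und C (prods C Vs) = tuple ` listset (map (Und C) Vs)"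
  using prods_characterization by blast

lemma tuple_in_prods:
  "set Vs \<subseteq> Ob C \<Longrightarrow> tuple xs \<in> Und C (prods C Vs) \<longleftrightarrow> list_all2 (\<lambda>x V. x \<in> Und C V) xs Vs"
  by (auto simp: Und_prods image_iff listset_iff_list_all2 list_all2_map2)

lemma prods_cases:
  assumes "z \<in> Und C (prods C Vs)" "set Vs \<subseteq> Ob C"
  obtains xs where "z = tuple xs" "list_all2 (\<lambda>x V. x \<in> Und C V) xs Vs"
  using assms by (auto simp: Und_prods listset_iff_list_all2 list_all2_map2)

section \<open>Admissible functions into and out of finite products\<close>

lemma adm_prods:
  assumes "set Vs \<subseteq> Ob C" "W \<in> Ob C" "length fs = length Vs"
    "\<And>i. i < length Vs \<Longrightarrow> adm C W (Vs ! i) (fs ! i)"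
  shows "adm C W (prods C Vs) (\<lambda>x. tuple (map (\<lambda>f. f x) fs))"
proof -
  have "(\<lambda>x. tuple (map (\<lambda>f. f x) fs)) \<in> Und C W \<rightarrow> tuple ` listset (map (Und C) Vs)"
    using adm_in[OF assms(4)] assms(3)
    by (force simp: listset_iff_list_all2 list_all2_conv_all_nth)
  then show ?thesis
    using prods_characterization[OF assms(1)] assms by simp
qed

lemma adm_proj:
  assumes "set Vs \<subseteq> Ob C" "i < length Vs"
  shows "adm C (prods C Vs) (Vs ! i) (\<lambda>z. untuple z ! i)"
  using prods_characterization[OF assms(1), THEN conjunct2, THEN conjunct2, rule_format,
      of "prods C Vs" "\<lambda>x. x"] adm_id[of "prods C Vs"] prods_characterization[OF assms(1)] assms(2) by simp

lemma adm_pair: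
  assumes "adm C W V f" "adm C W V' g"
  shows "adm C W (prods C [V, V']) (\<lambda>x. tuple [f x, g x])"
proof -
  have "adm C W ([V, V'] ! i) ([f, g] ! i)" if "i < length [V, V']" for i
    using that assms by (auto simp: less_Suc_eq)
  then show ?thesis
    using adm_prods[of "[V, V']" W "[f, g]"] adm_Ob[OF assms(1)] adm_Ob[OF assms(2)] by simp
qed

lemma adm_fst:
  assumes "V \<in> Ob C" "V' \<in> Ob C"
  shows "adm C (prods C [V, V']) V (\<lambda>z. untuple z ! 0)"
  using adm_proj[of "[V, V']" 0] assms by simp

lemma adm_snd:
  assumes "V \<in> Ob C" "V' \<in> Ob C"
  shows "adm C (prods C [V, V']) V' (\<lambda>z. untuple z ! 1)"
  using adm_proj[of "[V, V']" 1] assms by simp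

lemma pair_cases:
  assumes "z \<in> Und C (prods C [V, V'])" "V \<in> Ob C" "V' \<in> Ob C"
  obtains x y where "z = tuple [x, y]" "x \<in> Und C V" "y \<in> Und C V'"
  using assms by (auto elim!: prods_cases simp: list_all2_Cons2)

lemma pair_in_prods:
  assumes "V \<in> Ob C" "V' \<in> Ob C"
  shows "tuple [x, y] \<in> Und C (prods C [V, V']) \<longleftrightarrow> x \<in> Und C V \<and> y \<in> Und C V'"
  using assms by (simp add: tuple_in_prods)

text \<open>Together with \<open>adm_hd\<close> and \<open>adm_tl\<close> this relates the product
  of \<open>V # Vs\<close> to the binary product of \<open>V\<close> with the product of
  \<open>Vs\<close>, so that inductions on arities can work with binary products.\<close>

lemma adm_Cons:
  assumes "adm C W V f" "adm C W (prods C Vs) g" "set Vs \<subseteq> Ob C"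
  shows "adm C W (prods C (V # Vs)) (\<lambda>x. tuple (f x # untuple (g x)))"
proof -
  let ?fs = "f # map (\<lambda>i x. untuple (g x) ! i) [0..<length Vs]"
  have W: "W \<in> Ob C" "V \<in> Ob C"
    using adm_Ob[OF assms(1)] by auto
  have "adm C W ((V # Vs) ! i) (?fs ! i)" if "i < length (V # Vs)" for i
    using that assms(1) adm_comp[OF assms(2) adm_proj[OF assms(3)]] by (cases i) auto
  then have "adm C W (prods C (V # Vs)) (\<lambda>x. tuple (map (\<lambda>f. f x) ?fs))"
    using W assms(3) by (intro adm_prods) auto
  \<comment> \<open>Agreement rests on \<open>untuple (g x)\<close> having the length of
    \<open>Vs\<close>, which holds for \<open>x\<close> in the carrier of \<open>W\<close>.\<close>
  moreover have "tuple (map (\<lambda>f. f x) ?fs) = tuple (f x # untuple (g x))" if x: "x \<in> Und C W" for x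
  proof -
    obtain xs where xs: "g x = tuple xs" "list_all2 (\<lambda>x V. x \<in> Und C V) xs Vs"
      by (rule prods_cases[OF adm_in[OF assms(2) x] assms(3)])
    then have "map (\<lambda>i. xs ! i) [0..<length Vs] = xs"
      by (metis map_nth list_all2_lengthD)
    then show ?thesis
      using xs by (simp add: comp_def)
  qed
  ultimately show ?thesis
    by (rule adm_transfer)
qed

lemma adm_hd:
  assumes "set (V # Vs) \<subseteq> Ob C"
  shows "adm C (prods C (V # Vs)) V (\<lambda>z. hd (untuple z))"
proof -
  have "untuple z ! 0 = hd (untuple z)" if z: "z \<in> Und C (prods C (V # Vs))" for z
  proof -
    obtain xs where "z = tuple xs" "list_all2 (\<lambda>x V. x \<in> Und C V) xs (V # Vs)"
      by (rule prods_cases[OF z assms])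
    then show ?thesis
      by (auto simp: list_all2_Cons2)
  qed
  moreover have "adm C (prods C (V # Vs)) V (\<lambda>z. untuple z ! 0)"
    using adm_proj[OF assms, of 0] by simp
  ultimately show ?thesis
    by (simp cong: adm_cong)
qed

lemma adm_tl:
  assumes "set (V # Vs) \<subseteq> Ob C"
  shows "adm C (prods C (V # Vs)) (prods C Vs) (\<lambda>z. tuple (tl (untuple z)))"
proof -
  let ?fs = "map (\<lambda>i z. untuple z ! Suc i) [0..<length Vs]"
  have "adm C (prods C (V # Vs)) (prods C Vs) (\<lambda>x. tuple (map (\<lambda>f. f x) ?fs))"
  proof (rule adm_prods)
    show "adm C (prods C (V # Vs)) (Vs ! i) (?fs ! i)" if "i < length Vs" for i
      using adm_proj[OF assms, of "Suc i"] that by simp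
  qed (use assms prods_Ob in auto)
  moreover have "tuple (map (\<lambda>f. f z) ?fs) = tuple (tl (untuple z))"
    if z: "z \<in> Und C (prods C (V # Vs))" for z
  proof -
    obtain xs where "z = tuple xs" "list_all2 (\<lambda>x V. x \<in> Und C V) xs (V # Vs)"
      by (rule prods_cases[OF z assms])
    then show ?thesis
      by (auto intro!: nth_equalityI simp: nth_tl dest!: list_all2_lengthD)
  qed
  ultimately show ?thesis
    by (rule adm_transfer)
qed

end


section \<open>Quotient maps in cartesian closed topological categories\<close>

text \<open>A final surjection, with finality cut down to the implication that does not already
  follow by composing with \<open>q\<close>.\<close>

definition quotient_map :: "('u, 'v) concrete \<Rightarrow> 'v \<Rightarrow> 'v \<Rightarrow> ('u \<Rightarrow> 'u) \<Rightarrow> bool" where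
  "quotient_map C V Q q \<longleftrightarrow> adm C V Q q \<and> q ` Und C V = Und C Q \<and>
     (\<forall>W h. adm C V W (\<lambda>x. h (q x)) \<longrightarrow> adm C Q W h)"

lemma quotient_mapD:
  assumes "quotient_map C V Q q"
  shows "adm C V Q q" "q ` Und C V = Und C Q" "adm C V W (\<lambda>x. h (q x)) \<Longrightarrow> adm C Q W h"
  using assms by (auto simp: quotient_map_def)

lemma quotient_map_cong:
  assumes "\<And>x. x \<in> Und C V \<Longrightarrow> q x = r x"
  shows "quotient_map C V Q q \<longleftrightarrow> quotient_map C V Q r"
proof -
  have "adm C V Q q \<longleftrightarrow> adm C V Q r"
    using assms by (rule adm_cong)
  moreover have "adm C V W (\<lambda>x. h (q x)) \<longleftrightarrow> adm C V W (\<lambda>x. h (r x))" for W h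
    using assms by (intro adm_cong) simp
  moreover have "q ` Und C V = r ` Und C V"
    using assms by (rule image_cong[OF refl])
  ultimately show ?thesis
    unfolding quotient_map_def by simp
qed

context concrete_category
begin

lemma quotient_map_comp:
  assumes "quotient_map C V Q q" "quotient_map C Q R r"
  shows "quotient_map C V R (\<lambda>x. r (q x))"
proof -
  have "adm C V R (\<lambda>x. r (q x))"
    by (rule adm_comp[OF quotient_mapD(1)[OF assms(1)] quotient_mapD(1)[OF assms(2)]])
  moreover have "(\<lambda>x. r (q x)) ` Und C V = Und C R"
    using quotient_mapD(2)[OF assms(1)] quotient_mapD(2)[OF assms(2)] by (simp flip: image_image)
  moreover have "adm C R W h" if "adm C V W (\<lambda>x. h (r (q x)))" for W h
    using quotient_mapD(3)[OF assms(2) quotient_mapD(3)[OF assms(1), of W "\<lambda>x. h (r x)"]] that .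
  ultimately show ?thesis
    by (simp add: quotient_map_def)
qed

text \<open>Precomposing the composite of \<open>r\<close> and \<open>h\<close> with the section
  \<open>i\<close> recovers \<open>h\<close>. For rearrangements of factors this leaves one of the
  two inverse identities to compute.\<close>

lemma quotient_map_retraction:
  assumes "adm C V Q r" "adm C Q V i" "\<And>x. x \<in> Und C Q \<Longrightarrow> r (i x) = x"
  shows "quotient_map C V Q r"
proof -
  have "r ` Und C V = Und C Q"
    using adm_in[OF assms(1)] adm_in[OF assms(2)] assms(3) by (force simp: image_iff)
  moreover have "adm C Q W h" if "adm C V W (\<lambda>x. h (r x))" for W h
    using adm_transfer[OF adm_comp[OF assms(2) that], of h] assms(3) by simp
  ultimately show ?thesis
    using assms(1) by (simp add: quotient_map_def)
qed

end

lemma (in topological_category) quotient_map_final_structure: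
  assumes "small Y" "V \<in> Ob C" "q \<in> extensional (Und C V)" "q ` Und C V = Y"
  shows "quotient_map C V (final_structure C Y {(V, q)}) q"
proof -
  have q: "q \<in> Und C V \<rightarrow>\<^sub>E Y"
    using assms(3,4) by (auto simp: PiE_iff)
  note Q = final_structure_adm[OF assms(1,2) q]
  have "adm C V (final_structure C Y {(V, q)}) q"
    using Q(3)[of _ "\<lambda>x. x"] adm_id[OF Q(1)] by blast
  moreover have "adm C (final_structure C Y {(V, q)}) W h" if "adm C V W (\<lambda>x. h (q x))" for W h
    unfolding Q(3) using that adm_Ob[OF that] adm_in[OF that] assms(4) by auto
  ultimately show ?thesis
    using Q(2) assms(4) by (simp add: quotient_map_def)
qed

section \<open>Exponentials and products of quotient maps\<close>

locale cartesian_closed_topological = topological_category +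
  assumes cartesian_closed: "cartesian_closed C"
begin

text \<open>Uniqueness of transposes is recorded in the form that \<open>ev\<close> separates the
  points of \<open>E\<close>; the descent of a transpose along a quotient map relies on exactly
  this.\<close>

lemma exponential:
  assumes V: "V \<in> Ob C" and W: "W \<in> Ob C"
  obtains E ev where "E \<in> Ob C" "adm C (prods C [E, V]) W ev"
    "\<And>Z f. Z \<in> Ob C \<Longrightarrow> adm C (prods C [Z, V]) W f \<Longrightarrow>
      \<exists>g. adm C Z E g \<and> (\<forall>z\<in>Und C Z. \<forall>v\<in>Und C V. ev (tuple [g z, v]) = f (tuple [z, v]))"
    "\<And>e e'. e \<in> Und C E \<Longrightarrow> e' \<in> Und C E \<Longrightarrow>
      (\<And>v. v \<in> Und C V \<Longrightarrow> ev (tuple [e, v]) = ev (tuple [e', v])) \<Longrightarrow> e = e'"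
proof -
  obtain E ev where E: "E \<in> Ob C" and ev: "ev \<in> Hom C (prods C [E, V]) W"
    and univ: "\<And>Z f. Z \<in> Ob C \<Longrightarrow> f \<in> Hom C (prods C [Z, V]) W \<Longrightarrow> \<exists>!g. g \<in> Hom C Z E \<and>
      compose (Und C (prods C [Z, V])) ev (prods_map C [Z, V] [g, ident C V]) = f"
    using cartesian_closed[unfolded cartesian_closed_def, THEN bspec, OF V, THEN bspec, OF W]
    by blast
  have adm_ev: "adm C (prods C [E, V]) W ev"
    using ev Hom_iff_adm[of "prods C [E, V]" W] prods_Ob E V W by simp
  have comp: "compose (Und C (prods C [Z, V])) ev (prods_map C [Z, V] [g, ident C V]) (tuple [z, v]) =
      ev (tuple [g z, v])" if "Z \<in> Ob C" "z \<in> Und C Z" "v \<in> Und C V" for Z g z v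
    using that V by (simp add: compose_eq prods_map_def pair_in_prods ident_def)
  have comp_ext: "compose (Und C (prods C [Z, V])) ev (prods_map C [Z, V] [g, ident C V]) = f"
    if Z: "Z \<in> Ob C" and f: "f \<in> extensional (Und C (prods C [Z, V]))"
      and eq: "\<And>z v. z \<in> Und C Z \<Longrightarrow> v \<in> Und C V \<Longrightarrow> ev (tuple [g z, v]) = f (tuple [z, v])"
    for Z g f
  proof (rule extensionalityI[OF compose_extensional f])
    fix x assume x: "x \<in> Und C (prods C [Z, V])"
    obtain z v where "x = tuple [z, v]" "z \<in> Und C Z" "v \<in> Und C V"
      by (rule pair_cases[OF x Z V])
    then show "compose (Und C (prods C [Z, V])) ev (prods_map C [Z, V] [g, ident C V]) x = f x"
      using comp[OF Z] eq by simp
  qed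
  have curry: "\<exists>g. adm C Z E g \<and> (\<forall>z\<in>Und C Z. \<forall>v\<in>Und C V. ev (tuple [g z, v]) = f (tuple [z, v]))"
    if Z: "Z \<in> Ob C" and f: "adm C (prods C [Z, V]) W f" for Z f
  proof -
    obtain g where g: "g \<in> Hom C Z E"
      "compose (Und C (prods C [Z, V])) ev (prods_map C [Z, V] [g, ident C V]) =
        restrict f (Und C (prods C [Z, V]))"
      using univ[OF Z adm_restrict_Hom[OF f]] by blast
    have "ev (tuple [g z, v]) = f (tuple [z, v])" if "z \<in> Und C Z" "v \<in> Und C V" for z v
      using comp[OF Z that, of g] that Z V unfolding g(2) by (simp add: pair_in_prods)
    moreover have "adm C Z E g"
      using g(1) Hom_iff_adm[OF Z E] by simp
    ultimately show ?thesis
      by blast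
  qed
  (* Global points need not separate elements of E, as constant functions need not be admissible;
     generalized elements with a discrete domain do. *)
  have "e = e'" if e: "e \<in> Und C E" and e': "e' \<in> Und C E"
    and eq: "\<And>v. v \<in> Und C V \<Longrightarrow> ev (tuple [e, v]) = ev (tuple [e', v])" for e e'
  proof -
    have "small {e}"
      by (simp add: small_finite)
    then obtain D where D: "D \<in> Ob C" "Und C D = {e}"
      and disc: "\<And>W h. W \<in> Ob C \<Longrightarrow> h \<in> {e} \<rightarrow> Und C W \<Longrightarrow> adm C D W h"
      using discrete_object by metis
    \<comment> \<open>The constant function with value \<open>e\<close>, uncurried. By the
      hypothesis on \<open>e\<close> and \<open>e'\<close>, both constant functions on
      \<open>D\<close> are transposes of it, so uniqueness identifies them.\<close>
    let ?f = "\<lambda>z\<in>Und C (prods C [D, V]). ev (tuple [e, untuple z ! 1])"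
    have const: "(\<lambda>z\<in>{e}. c) \<in> Hom C D E" if "c \<in> Und C E" for c
      using adm_restrict_Hom[OF disc[OF E, of "\<lambda>_. c"]] that D(2) by simp
    have "adm C D E (\<lambda>_. e)"
      using disc[OF E] e by simp
    then have "adm C (prods C [D, V]) W (\<lambda>z. ev (tuple [e, untuple z ! 1]))"
      by (rule adm_comp[OF adm_pair[OF adm_comp[OF adm_fst[OF D(1) V]] adm_snd[OF D(1) V]] adm_ev])
    then have f: "?f \<in> Hom C (prods C [D, V]) W"
      by (rule adm_restrict_Hom)
    have "compose (Und C (prods C [D, V])) ev (prods_map C [D, V] [\<lambda>z\<in>{e}. c, ident C V]) = ?f"
      if "\<And>v. v \<in> Und C V \<Longrightarrow> ev (tuple [e, v]) = ev (tuple [c, v])" for c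
      using that D V by - (rule comp_ext, auto simp: pair_in_prods)
    then have "(\<lambda>z\<in>{e}. e) = (\<lambda>z\<in>{e}. e')"
      using univ[OF D(1) f] const[OF e] const[OF e'] eq by blast
    then show ?thesis
      by (metis restrict_apply' singletonI)
  qed
  with E adm_ev curry show thesis
    by (rule that)
qed

(* A functor that has a right adjoint preserves quotient maps. *)
lemma quotient_map_times:
  assumes q: "quotient_map C V Q q" and Z: "Z \<in> Ob C"
  shows "quotient_map C (prods C [V, Z]) (prods C [Q, Z])
    (\<lambda>x. tuple [q (untuple x ! 0), untuple x ! 1])" (is "quotient_map C _ _ ?r")
proof -
  have V: "V \<in> Ob C" and Q: "Q \<in> Ob C"
    using adm_Ob[OF quotient_mapD(1)[OF q]] by auto
  have "adm C (prods C [V, Z]) (prods C [Q, Z]) ?r"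
    using adm_pair[OF adm_comp[OF adm_fst[OF V Z] quotient_mapD(1)[OF q]] adm_snd[OF V Z]] .
  moreover have "?r ` Und C (prods C [V, Z]) = Und C (prods C [Q, Z])"
  proof
    show "?r ` Und C (prods C [V, Z]) \<subseteq> Und C (prods C [Q, Z])"
      using adm_in[OF calculation] by blast
    show "Und C (prods C [Q, Z]) \<subseteq> ?r ` Und C (prods C [V, Z])"
    proof
      fix x assume x: "x \<in> Und C (prods C [Q, Z])"
      obtain c z where cz: "x = tuple [c, z]" "c \<in> Und C Q" "z \<in> Und C Z"
        by (rule pair_cases[OF x Q Z])
      then obtain a where "a \<in> Und C V" "c = q a"
        using quotient_mapD(2)[OF q] by blast
      then have "x = ?r (tuple [a, z])" "tuple [a, z] \<in> Und C (prods C [V, Z])"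
        using cz V Z by (simp_all add: pair_in_prods)
      then show "x \<in> ?r ` Und C (prods C [V, Z])"
        by blast
    qed
  qed
  moreover have "adm C (prods C [Q, Z]) W h" if h: "adm C (prods C [V, Z]) W (\<lambda>x. h (?r x))" for W h
  proof -
    obtain E ev where E: "E \<in> Ob C" and ev: "adm C (prods C [E, Z]) W ev"
      and curry: "\<And>Y f. Y \<in> Ob C \<Longrightarrow> adm C (prods C [Y, Z]) W f \<Longrightarrow>
        \<exists>g. adm C Y E g \<and> (\<forall>y\<in>Und C Y. \<forall>z\<in>Und C Z. ev (tuple [g y, z]) = f (tuple [y, z]))"
      and sep: "\<And>e e'. e \<in> Und C E \<Longrightarrow> e' \<in> Und C E \<Longrightarrow>
        (\<And>z. z \<in> Und C Z \<Longrightarrow> ev (tuple [e, z]) = ev (tuple [e', z])) \<Longrightarrow> e = e'"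
      by (rule exponential[OF Z adm_Ob(2)[OF h]]) blast
    obtain g where g: "adm C V E g"
      and ev_g: "\<And>a z. a \<in> Und C V \<Longrightarrow> z \<in> Und C Z \<Longrightarrow> ev (tuple [g a, z]) = h (tuple [q a, z])"
      using curry[OF V h] by auto
    \<comment> \<open>The transpose of \<open>h\<close> is found by choosing preimages under
      \<open>q\<close>. The choice does not matter: \<open>ev (tuple [g a, z])\<close> depends on
      \<open>a\<close> only through \<open>q a\<close>, and \<open>ev\<close> separates
      points.\<close>
    let ?k = "\<lambda>c. g (inv_into (Und C V) q c)"
    have inv: "inv_into (Und C V) q c \<in> Und C V" "q (inv_into (Und C V) q c) = c"
      if "c \<in> Und C Q" for c
      using that quotient_mapD(2)[OF q] by (metis inv_into_into, metis f_inv_into_f)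
    have "g a = ?k (q a)" if a: "a \<in> Und C V" for a
    proof -
      have "q a \<in> Und C Q"
        using a quotient_mapD(2)[OF q] by blast
      then show ?thesis
        using inv[of "q a"] a adm_in[OF g] ev_g by - (rule sep, simp_all)
    qed
    then have "adm C Q E ?k"
      using quotient_mapD(3)[OF q, of E ?k] adm_transfer[OF g, of "\<lambda>a. ?k (q a)"] by blast
    \<comment> \<open>Uncurrying the descended transpose gives back \<open>h\<close> on the product
      with \<open>Q\<close>.\<close>
    then have "adm C (prods C [Q, Z]) W (\<lambda>x. ev (tuple [?k (untuple x ! 0), untuple x ! 1]))"
      by (rule adm_comp[OF adm_pair[OF adm_comp[OF adm_fst[OF Q Z]] adm_snd[OF Q Z]] ev])
    then show ?thesis
    proof (rule adm_transfer)
      fix x assume x: "x \<in> Und C (prods C [Q, Z])"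
      obtain c z where "x = tuple [c, z]" "c \<in> Und C Q" "z \<in> Und C Z"
        by (rule pair_cases[OF x Q Z])
      then show "ev (tuple [?k (untuple x ! 0), untuple x ! 1]) = h x"
        using ev_g inv by simp
    qed
  qed
  ultimately show ?thesis
    by (simp add: quotient_map_def)
qed

text \<open>One factor is replaced at a time. Once \<open>A s\<close> has become \<open>Q s\<close>
  it is absorbed into the fixed object, so the induction hypothesis is used at
  \<open>prods C [Z, Q s]\<close>; this is why \<open>Z\<close> is generalized.\<close>

lemma quotient_map_prods:
  assumes "\<And>s. s \<in> set ss \<Longrightarrow> quotient_map C (A s) (Q s) (q s)" "Z \<in> Ob C"
  shows "quotient_map C (prods C [Z, prods C (map A ss)]) (prods C [Z, prods C (map Q ss)])
    (\<lambda>x. tuple [untuple x ! 0, tuple (map2 q ss (untuple (untuple x ! 1)))])"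
  using assms
proof (induction ss arbitrary: Z)
  case Nil
  have P: "prods C [] \<in> Ob C"
    by (simp add: prods_Ob)
  have "quotient_map C (prods C [Z, prods C []]) (prods C [Z, prods C []]) (\<lambda>x. x)"
    using prods_Ob[of "[Z, prods C []]"] P Nil
    by (intro quotient_map_retraction[OF adm_id adm_id]) simp_all
  moreover have "x = tuple [untuple x ! 0, tuple []]" if x: "x \<in> Und C (prods C [Z, prods C []])" for x
    by (rule pair_cases[OF x Nil(2) P]) (simp add: Und_prods)
  ultimately have "quotient_map C (prods C [Z, prods C []]) (prods C [Z, prods C []])
      (\<lambda>x. tuple [untuple x ! 0, tuple []])"
    by (rule quotient_map_cong[THEN iffD1, rotated])
  then show ?case
    by simp
next
  case (Cons s ss)
  have q: "quotient_map C (A s) (Q s) (q s)"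
    using Cons.prems by simp
  have "A t \<in> Ob C \<and> Q t \<in> Ob C" if "t \<in> set (s # ss)" for t
    using adm_Ob[OF quotient_mapD(1)[OF Cons.prems(1)[OF that]]] by simp
  then have Ob: "A s \<in> Ob C" "Q s \<in> Ob C" "set (map A ss) \<subseteq> Ob C" "set (map Q ss) \<subseteq> Ob C" "Z \<in> Ob C"
    using Cons.prems(2) by auto
  let ?As = "prods C (map A ss)" and ?Qs = "prods C (map Q ss)"
  let ?AAs = "prods C (map A (s # ss))" and ?QQs = "prods C (map Q (s # ss))"
  have As: "?As \<in> Ob C" "?Qs \<in> Ob C" "?AAs \<in> Ob C" "?QQs \<in> Ob C"
    "prods C [Z, ?As] \<in> Ob C" "prods C [Z, Q s] \<in> Ob C"
    using Ob by (simp_all add: prods_Ob)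
  have hd_A: "adm C ?AAs (A s) (\<lambda>z. hd (untuple z))" and tl_A: "adm C ?AAs ?As (\<lambda>z. tuple (tl (untuple z)))"
    using adm_hd[of "A s" "map A ss"] adm_tl[of "A s" "map A ss"] Ob by simp_all
  have hd_Q: "adm C ?QQs (Q s) (\<lambda>z. hd (untuple z))" and tl_Q: "adm C ?QQs ?Qs (\<lambda>z. tuple (tl (untuple z)))"
    using adm_hd[of "Q s" "map Q ss"] adm_tl[of "Q s" "map Q ss"] Ob by simp_all
  have AAs_cases: "\<exists>a as. y = tuple (a # as) \<and> a \<in> Und C (A s) \<and> tuple as \<in> Und C ?As"
    if "y \<in> Und C ?AAs" for y
    using that Ob by (auto simp: Und_prods set_Cons_def)
  have QQs_cases: "\<exists>a as. y = tuple (a # as) \<and> a \<in> Und C (Q s) \<and> tuple as \<in> Und C ?Qs"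
    if "y \<in> Und C ?QQs" for y
    using that Ob by (auto simp: Und_prods set_Cons_def)
  \<comment> \<open>\<open>quotient_map_times\<close> acts on the first factor, so
    \<open>?r1\<close> brings the head of the list to the front; \<open>?i1\<close> is a section of
    it.\<close>
  let ?r1 = "\<lambda>x. tuple [hd (untuple (untuple x ! 1)),
    tuple [untuple x ! 0, tuple (tl (untuple (untuple x ! 1)))]]"
  let ?i1 = "\<lambda>x. tuple [untuple (untuple x ! 1) ! 0,
    tuple (untuple x ! 0 # untuple (untuple (untuple x ! 1) ! 1))]"
  have "quotient_map C (prods C [Z, ?AAs]) (prods C [A s, prods C [Z, ?As]]) ?r1"
  proof (rule quotient_map_retraction)
    show "adm C (prods C [Z, ?AAs]) (prods C [A s, prods C [Z, ?As]]) ?r1"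
      by (rule adm_pair[OF adm_comp[OF adm_snd[OF Ob(5) As(3)] hd_A]
            adm_pair[OF adm_fst[OF Ob(5) As(3)] adm_comp[OF adm_snd[OF Ob(5) As(3)] tl_A]]])
    show "adm C (prods C [A s, prods C [Z, ?As]]) (prods C [Z, ?AAs]) ?i1"
      unfolding list.map
      by (rule adm_pair[OF adm_comp[OF adm_snd[OF Ob(1) As(5)] adm_fst[OF Ob(5) As(1)]]
            adm_Cons[OF adm_fst[OF Ob(1) As(5)]
              adm_comp[OF adm_snd[OF Ob(1) As(5)] adm_snd[OF Ob(5) As(1)]] Ob(3)]])
    fix x assume x: "x \<in> Und C (prods C [A s, prods C [Z, ?As]])"
    obtain a y where "x = tuple [a, y]" and y: "y \<in> Und C (prods C [Z, ?As])"
      by (rule pair_cases[OF x Ob(1) As(5)])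
    moreover obtain z as where "y = tuple [z, as]" "as \<in> Und C ?As"
      by (rule pair_cases[OF y Ob(5) As(1)])
    moreover obtain bs where "as = tuple bs"
      using calculation Ob(3) by (auto simp: Und_prods)
    ultimately show "?r1 (?i1 x) = x"
      by simp
  qed
  moreover have "quotient_map C (prods C [A s, prods C [Z, ?As]]) (prods C [Q s, prods C [Z, ?As]])
      (\<lambda>x. tuple [q s (untuple x ! 0), untuple x ! 1])"
    by (rule quotient_map_times[OF q As(5)])
  moreover
  \<comment> \<open>Moves the replaced head into the fixed object, leaving the tail for the
    induction hypothesis.\<close>
  let ?r2 = "\<lambda>x. tuple [tuple [untuple (untuple x ! 1) ! 0, untuple x ! 0], untuple (untuple x ! 1) ! 1]"
  let ?i2 = "\<lambda>x. tuple [untuple (untuple x ! 0) ! 1, tuple [untuple (untuple x ! 0) ! 0, untuple x ! 1]]"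
  have "quotient_map C (prods C [Q s, prods C [Z, ?As]]) (prods C [prods C [Z, Q s], ?As]) ?r2"
  proof (rule quotient_map_retraction)
    show "adm C (prods C [Q s, prods C [Z, ?As]]) (prods C [prods C [Z, Q s], ?As]) ?r2"
      by (rule adm_pair[OF adm_pair[OF adm_comp[OF adm_snd[OF Ob(2) As(5)] adm_fst[OF Ob(5) As(1)]]
            adm_fst[OF Ob(2) As(5)]] adm_comp[OF adm_snd[OF Ob(2) As(5)] adm_snd[OF Ob(5) As(1)]]])
    show "adm C (prods C [prods C [Z, Q s], ?As]) (prods C [Q s, prods C [Z, ?As]]) ?i2"
      by (rule adm_pair[OF adm_comp[OF adm_fst[OF As(6,1)] adm_snd[OF Ob(5,2)]]
            adm_pair[OF adm_comp[OF adm_fst[OF As(6,1)] adm_fst[OF Ob(5,2)]] adm_snd[OF As(6,1)]]])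
    fix x assume x: "x \<in> Und C (prods C [prods C [Z, Q s], ?As])"
    obtain y as where "x = tuple [y, as]" and y: "y \<in> Und C (prods C [Z, Q s])"
      by (rule pair_cases[OF x As(6,1)])
    moreover obtain z c where "y = tuple [z, c]"
      by (rule pair_cases[OF y Ob(5,2)])
    ultimately show "?r2 (?i2 x) = x"
      by simp
  qed
  moreover
  let ?t = "\<lambda>x. tuple [untuple x ! 0, tuple (map2 q ss (untuple (untuple x ! 1)))]"
  have "quotient_map C (prods C [prods C [Z, Q s], ?As]) (prods C [prods C [Z, Q s], ?Qs]) ?t"
    using Cons.prems As(6) by (intro Cons.IH) auto
  moreover
  \<comment> \<open>Returns the replaced head from the fixed object to the list.\<close>
  let ?r3 = "\<lambda>x. tuple [untuple (untuple x ! 0) ! 0, tuple (untuple (untuple x ! 0) ! 1 # untuple (untuple x ! 1))]"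
  let ?i3 = "\<lambda>x. tuple [tuple [untuple x ! 0, hd (untuple (untuple x ! 1))], tuple (tl (untuple (untuple x ! 1)))]"
  have "quotient_map C (prods C [prods C [Z, Q s], ?Qs]) (prods C [Z, ?QQs]) ?r3"
  proof (rule quotient_map_retraction)
    show "adm C (prods C [prods C [Z, Q s], ?Qs]) (prods C [Z, ?QQs]) ?r3"
      unfolding list.map
      by (rule adm_pair[OF adm_comp[OF adm_fst[OF As(6,2)] adm_fst[OF Ob(5,2)]]
            adm_Cons[OF adm_comp[OF adm_fst[OF As(6,2)] adm_snd[OF Ob(5,2)]] adm_snd[OF As(6,2)] Ob(4)]])
    show "adm C (prods C [Z, ?QQs]) (prods C [prods C [Z, Q s], ?Qs]) ?i3"
      by (rule adm_pair[OF adm_pair[OF adm_fst[OF Ob(5) As(4)] adm_comp[OF adm_snd[OF Ob(5) As(4)] hd_Q]]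
            adm_comp[OF adm_snd[OF Ob(5) As(4)] tl_Q]])
    fix x assume x: "x \<in> Und C (prods C [Z, ?QQs])"
    obtain z y where "x = tuple [z, y]" and y: "y \<in> Und C ?QQs"
      by (rule pair_cases[OF x Ob(5) As(4)])
    then show "?r3 (?i3 x) = x"
      using QQs_cases[OF y] by auto
  qed
  ultimately have "quotient_map C (prods C [Z, ?AAs]) (prods C [Z, ?QQs])
      (\<lambda>x. ?r3 (?t (?r2 ((\<lambda>x. tuple [q s (untuple x ! 0), untuple x ! 1]) (?r1 x)))))"
    by (rule quotient_map_comp[OF quotient_map_comp[OF quotient_map_comp[OF quotient_map_comp]]])
  moreover have "?r3 (?t (?r2 ((\<lambda>x. tuple [q s (untuple x ! 0), untuple x ! 1]) (?r1 x)))) =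
      tuple [untuple x ! 0, tuple (map2 q (s # ss) (untuple (untuple x ! 1)))]"
    if x: "x \<in> Und C (prods C [Z, ?AAs])" for x
  proof -
    obtain z y where "x = tuple [z, y]" and y: "y \<in> Und C ?AAs"
      by (rule pair_cases[OF x Ob(5) As(3)])
    then show ?thesis
      using AAs_cases[OF y] by auto
  qed
  ultimately show ?case
    by (rule quotient_map_cong[THEN iffD1, rotated])
qed

end


section \<open>Algebras in terms of elements\<close>

locale enriched_algebras = cartesian_closed_topological C
  for C :: "('u::set_universe, 'v) concrete" +
  fixes S :: "'s set" and \<Sigma> :: "('f, 's, 'v) enriched_signature"
  assumes signature: "is_enriched_signature C S \<Sigma>"
begin

definition args :: "('s \<Rightarrow> 'v) \<Rightarrow> 's list \<Rightarrow> 'u list \<Rightarrow> bool" where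
  "args A ss xs \<longleftrightarrow> list_all2 (\<lambda>x s. x \<in> Und C (A s)) xs ss"

lemma signature_sorts:
  assumes "\<sigma> \<in> syms \<Sigma>"
  shows "set (ins \<Sigma> \<sigma>) \<subseteq> S" "out \<Sigma> \<sigma> \<in> S" "par \<Sigma> \<sigma> \<in> Ob C"
  using assms signature by (auto simp: is_enriched_signature_def)

lemma pow_Ob_in: "A \<in> pow_Ob C S \<Longrightarrow> s \<in> S \<Longrightarrow> A s \<in> Ob C"
  by (auto simp: pow_Ob_def)

lemma map_Ob: "A \<in> pow_Ob C S \<Longrightarrow> set ss \<subseteq> S \<Longrightarrow> set (map A ss) \<subseteq> Ob C"
  by (auto simp: pow_Ob_in)

lemma dom_Ob_Ob: "A \<in> pow_Ob C S \<Longrightarrow> set ss \<subseteq> S \<Longrightarrow> P \<in> Ob C \<Longrightarrow> dom_Ob C P ss A \<in> Ob C"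
  unfolding dom_Ob_def using map_Ob[of A ss] prods_Ob[of "map A ss"] by (intro prods_Ob) simp

lemma Und_dom_Ob:
  assumes "A \<in> pow_Ob C S" "set ss \<subseteq> S" "P \<in> Ob C"
  shows "tuple [p, tuple xs] \<in> Und C (dom_Ob C P ss A) \<longleftrightarrow> p \<in> Und C P \<and> args A ss xs"
  unfolding dom_Ob_def args_def using assms map_Ob[OF assms(1,2)]
  by (simp add: pair_in_prods prods_Ob tuple_in_prods list_all2_map2)

lemma dom_Ob_cases:
  assumes "z \<in> Und C (dom_Ob C P ss A)" "A \<in> pow_Ob C S" "set ss \<subseteq> S" "P \<in> Ob C"
  obtains p xs where "z = tuple [p, tuple xs]" "p \<in> Und C P" "args A ss xs"
proof -
  note Ob = map_Ob[OF assms(2,3)]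
  obtain p y where z: "z = tuple [p, y]" "p \<in> Und C P" "y \<in> Und C (prods C (map A ss))"
    by (rule pair_cases[OF assms(1)[unfolded dom_Ob_def] assms(4) prods_Ob[OF Ob]])
  moreover obtain xs where "y = tuple xs" "list_all2 (\<lambda>x V. x \<in> Und C V) xs (map A ss)"
    by (rule prods_cases[OF z(3) Ob])
  ultimately show thesis
    using that by (simp add: args_def list_all2_map2)
qed

lemma dom_map_tuple:
  assumes "A \<in> pow_Ob C S" "set ss \<subseteq> S" "P \<in> Ob C" "p \<in> Und C P" "args A ss xs"
  shows "dom_map C P ss A f (tuple [p, tuple xs]) = tuple [p, tuple (map2 f ss xs)]"
proof -
  note Ob = map_Ob[OF assms(1,2)]
  have "tuple xs \<in> Und C (prods C (map A ss))"
    using assms(5) Ob by (simp add: tuple_in_prods args_def list_all2_map2)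
  moreover from this have "tuple [p, tuple xs] \<in> Und C (prods C [P, prods C (map A ss)])"
    using assms Ob by (simp add: pair_in_prods prods_Ob)
  ultimately show ?thesis
    unfolding dom_map_def prods_map_def
    by (simp add: ident_def assms(4) zip_map1 case_prod_unfold)
qed

lemma pow_Hom_iff:
  assumes "A \<in> pow_Ob C S" "B \<in> pow_Ob C S"
  shows "f \<in> pow_Hom C S A B \<longleftrightarrow> f \<in> extensional S \<and>
    (\<forall>s\<in>S. adm C (A s) (B s) (f s) \<and> f s \<in> extensional (Und C (A s)))"
  unfolding pow_Hom_def PiE_iff
  using Hom_iff_adm[OF pow_Ob_in[OF assms(1)] pow_Ob_in[OF assms(2)]] by blast

lemma pow_Hom_adm:
  assumes "f \<in> pow_Hom C S A B" "A \<in> pow_Ob C S" "B \<in> pow_Ob C S" "s \<in> S"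
  shows "adm C (A s) (B s) (f s)"
  using assms pow_Hom_iff by blast

lemma pow_Hom_eqI:
  assumes "f \<in> pow_Hom C S A B" "g \<in> pow_Hom C S A B" "A \<in> pow_Ob C S" "B \<in> pow_Ob C S"
    "\<And>s x. s \<in> S \<Longrightarrow> x \<in> Und C (A s) \<Longrightarrow> f s x = g s x"
  shows "f = g"
proof (rule extensionalityI)
  show "f \<in> extensional S" "g \<in> extensional S"
    using assms pow_Hom_iff by blast+
  show "f s = g s" if "s \<in> S" for s
    using assms(1-4) pow_Hom_iff that assms(5)[OF that] by (intro extensionalityI) blast+
qed

lemma restrict_pow_Hom:
  assumes "A \<in> pow_Ob C S" "B \<in> pow_Ob C S" "\<And>s. s \<in> S \<Longrightarrow> adm C (A s) (B s) (f s)"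
  shows "(\<lambda>s\<in>S. \<lambda>x\<in>Und C (A s). f s x) \<in> pow_Hom C S A B"
proof -
  have "restrict (f s) (Und C (A s)) \<in> Hom C (A s) (B s)" if "s \<in> S" for s
    by (rule adm_restrict_Hom[OF assms(3)[OF that]])
  then show ?thesis
    unfolding pow_Hom_def by auto
qed

lemma Alg_car: "A \<in> Alg C S \<Sigma> \<Longrightarrow> car A \<in> pow_Ob C S"
  by (simp add: Alg_def)

lemma Alg_opn_in:
  assumes A: "A \<in> Alg C S \<Sigma>" and \<sigma>: "\<sigma> \<in> syms \<Sigma>" and "p \<in> Und C (par \<Sigma> \<sigma>)" "args (car A) (ins \<Sigma> \<sigma>) xs"
  shows "opn A \<sigma> (tuple [p, tuple xs]) \<in> Und C (car A (out \<Sigma> \<sigma>))"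
proof -
  note Ob = Alg_car[OF A] signature_sorts[OF \<sigma>]
  have "opn A \<sigma> \<in> Hom C (dom_Ob C (par \<Sigma> \<sigma>) (ins \<Sigma> \<sigma>) (car A)) (car A (out \<Sigma> \<sigma>))"
    using A \<sigma> by (auto simp: Alg_def)
  then have "adm C (dom_Ob C (par \<Sigma> \<sigma>) (ins \<Sigma> \<sigma>) (car A)) (car A (out \<Sigma> \<sigma>)) (opn A \<sigma>)"
    using Hom_iff_adm[OF dom_Ob_Ob pow_Ob_in] Ob by blast
  then show ?thesis
    using Und_dom_Ob[OF Ob(1,2,4)] assms(3,4) by (blast intro: adm_in)
qed

text \<open>The morphism condition for an operation symbol and the naturality square of an algebraic
  operation share this shape, so one translation to elements serves both.\<close>

lemma compose_dom_eq_iff: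
  assumes "A \<in> pow_Ob C S" "set ss \<subseteq> S" "P \<in> Ob C"
  shows "compose (Und C (dom_Ob C P ss A)) g a = compose (Und C (dom_Ob C P ss A)) b (dom_map C P ss A f) \<longleftrightarrow>
    (\<forall>p\<in>Und C P. \<forall>xs. args A ss xs \<longrightarrow>
      g (a (tuple [p, tuple xs])) = b (tuple [p, tuple (map2 f ss xs)]))" (is "?l = ?r \<longleftrightarrow> _")
proof
  assume eq: "?l = ?r"
  show "\<forall>p\<in>Und C P. \<forall>xs. args A ss xs \<longrightarrow>
      g (a (tuple [p, tuple xs])) = b (tuple [p, tuple (map2 f ss xs)])"
  proof (intro ballI allI impI)
    fix p xs assume p: "p \<in> Und C P" "args A ss xs"
    show "g (a (tuple [p, tuple xs])) = b (tuple [p, tuple (map2 f ss xs)])"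
      using fun_cong[OF eq, of "tuple [p, tuple xs]"] p assms
      by (simp add: compose_eq Und_dom_Ob dom_map_tuple)
  qed
next
  assume *: "\<forall>p\<in>Und C P. \<forall>xs. args A ss xs \<longrightarrow>
      g (a (tuple [p, tuple xs])) = b (tuple [p, tuple (map2 f ss xs)])"
  show "?l = ?r"
  proof (rule extensionalityI[OF compose_extensional compose_extensional])
    fix z assume z: "z \<in> Und C (dom_Ob C P ss A)"
    obtain p xs where "z = tuple [p, tuple xs]" "p \<in> Und C P" "args A ss xs"
      by (rule dom_Ob_cases[OF z assms])
    then show "?l z = ?r z"
      using z * assms by (simp add: compose_eq dom_map_tuple)
  qed
qed

lemma alg_Hom_iff:
  assumes "A \<in> Alg C S \<Sigma>"
  shows "f \<in> alg_Hom C S \<Sigma> A B \<longleftrightarrow> f \<in> pow_Hom C S (car A) (car B) \<and>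
    (\<forall>\<sigma>\<in>syms \<Sigma>. \<forall>p\<in>Und C (par \<Sigma> \<sigma>). \<forall>xs. args (car A) (ins \<Sigma> \<sigma>) xs \<longrightarrow>
      f (out \<Sigma> \<sigma>) (opn A \<sigma> (tuple [p, tuple xs])) =
      opn B \<sigma> (tuple [p, tuple (map2 f (ins \<Sigma> \<sigma>) xs)]))"
proof -
  have "compose (Und C (dom_Ob C (par \<Sigma> \<sigma>) (ins \<Sigma> \<sigma>) (car A))) (f (out \<Sigma> \<sigma>)) (opn A \<sigma>) =
      compose (Und C (dom_Ob C (par \<Sigma> \<sigma>) (ins \<Sigma> \<sigma>) (car A))) (opn B \<sigma>)
        (dom_map C (par \<Sigma> \<sigma>) (ins \<Sigma> \<sigma>) (car A) f) \<longleftrightarrow>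
      (\<forall>p\<in>Und C (par \<Sigma> \<sigma>). \<forall>xs. args (car A) (ins \<Sigma> \<sigma>) xs \<longrightarrow>
        f (out \<Sigma> \<sigma>) (opn A \<sigma> (tuple [p, tuple xs])) =
        opn B \<sigma> (tuple [p, tuple (map2 f (ins \<Sigma> \<sigma>) xs)]))" if "\<sigma> \<in> syms \<Sigma>" for \<sigma>
    by (rule compose_dom_eq_iff[OF Alg_car[OF assms] signature_sorts(1)[OF that] signature_sorts(3)[OF that]])
  then show ?thesis
    unfolding alg_Hom_def Let_def by (intro iffI) simp_all
qed

lemma alg_Hom_pow_Hom: "f \<in> alg_Hom C S \<Sigma> A B \<Longrightarrow> f \<in> pow_Hom C S (car A) (car B)"
  by (simp add: alg_Hom_def)

lemma args_map2:
  assumes "args A ss xs" "\<And>s x. s \<in> set ss \<Longrightarrow> x \<in> Und C (A s) \<Longrightarrow> f s x \<in> Und C (B s)"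
  shows "args B ss (map2 f ss xs)"
  using assms unfolding args_def by (auto simp: list_all2_conv_all_nth)

section \<open>Algebraic operations on elements\<close>

lemma algebraic_operation_in:
  assumes "algebraic_operation C S \<Sigma> \<omega>" "A \<in> Alg C S \<Sigma>" "p \<in> Und C (op_par \<omega>)" "args (car A) (op_ins \<omega>) xs"
  shows "component \<omega> A (tuple [p, tuple xs]) \<in> Und C (car A (op_out \<omega>))"
proof -
  have Ob: "car A \<in> pow_Ob C S" "set (op_ins \<omega>) \<subseteq> S" "op_par \<omega> \<in> Ob C" "op_out \<omega> \<in> S"
    and "component \<omega> A \<in> Hom C (dom_Ob C (op_par \<omega>) (op_ins \<omega>) (car A)) (car A (op_out \<omega>))"
    using assms(1,2) Alg_car by (auto simp: algebraic_operation_def Let_def)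
  then have "adm C (dom_Ob C (op_par \<omega>) (op_ins \<omega>) (car A)) (car A (op_out \<omega>)) (component \<omega> A)"
    using Hom_iff_adm[OF dom_Ob_Ob pow_Ob_in] by blast
  then show ?thesis
    using Und_dom_Ob[OF Ob(1-3)] assms(3,4) by (blast intro: adm_in)
qed

lemma algebraic_operation_natural:
  assumes \<omega>: "algebraic_operation C S \<Sigma> \<omega>" and A: "A \<in> Alg C S \<Sigma>" and B: "B \<in> Alg C S \<Sigma>"
    and f: "f \<in> alg_Hom C S \<Sigma> A B" and "p \<in> Und C (op_par \<omega>)" "args (car A) (op_ins \<omega>) xs"
  shows "f (op_out \<omega>) (component \<omega> A (tuple [p, tuple xs])) =
    component \<omega> B (tuple [p, tuple (map2 f (op_ins \<omega>) xs)])"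
proof -
  have Ob: "set (op_ins \<omega>) \<subseteq> S" "op_par \<omega> \<in> Ob C"
    using \<omega> by (auto simp: algebraic_operation_def)
  show ?thesis
    using \<omega> A B f compose_dom_eq_iff[OF Alg_car[OF A] Ob] assms(5,6)
    unfolding algebraic_operation_def Let_def by blast
qed

lemma algebraic_operation_eqI:
  assumes "algebraic_operation C S \<Sigma> \<omega>" "algebraic_operation C S \<Sigma> \<nu>"
    "op_ins \<omega> = op_ins \<nu>" "op_out \<omega> = op_out \<nu>" "op_par \<omega> = op_par \<nu>" "A \<in> Alg C S \<Sigma>"
    and eq: "\<And>p xs. p \<in> Und C (op_par \<omega>) \<Longrightarrow> args (car A) (op_ins \<omega>) xs \<Longrightarrow>
      component \<omega> A (tuple [p, tuple xs]) = component \<nu> A (tuple [p, tuple xs])"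
  shows "component \<omega> A = component \<nu> A"
proof -
  have Ob: "car A \<in> pow_Ob C S" "set (op_ins \<omega>) \<subseteq> S" "op_par \<omega> \<in> Ob C" "op_out \<omega> \<in> S"
    and "component \<omega> A \<in> Hom C (dom_Ob C (op_par \<omega>) (op_ins \<omega>) (car A)) (car A (op_out \<omega>))"
    "component \<nu> A \<in> Hom C (dom_Ob C (op_par \<omega>) (op_ins \<omega>) (car A)) (car A (op_out \<omega>))"
    using assms(1-6) Alg_car by (auto simp: algebraic_operation_def Let_def)
  then have "component \<omega> A \<in> extensional (Und C (dom_Ob C (op_par \<omega>) (op_ins \<omega>) (car A)))"
    "component \<nu> A \<in> extensional (Und C (dom_Ob C (op_par \<omega>) (op_ins \<omega>) (car A)))"
    using Hom_iff_adm[OF dom_Ob_Ob pow_Ob_in] by blast+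
  then show ?thesis
  proof (rule extensionalityI)
    fix z assume z: "z \<in> Und C (dom_Ob C (op_par \<omega>) (op_ins \<omega>) (car A))"
    obtain p xs where "z = tuple [p, tuple xs]" "p \<in> Und C (op_par \<omega>)" "args (car A) (op_ins \<omega>) xs"
      by (rule dom_Ob_cases[OF z Ob(1-3)])
    then show "component \<omega> A z = component \<nu> A z"
      using eq by simp
  qed
qed


section \<open>Algebraic operations and terms\<close>

text \<open>Every function into an indiscrete object is admissible. A classical algebra with small
  carriers thus becomes an enriched one whatever the structure of the parameters, and functions into
  it become morphisms by the algebraic condition alone.\<close>

lemma indisc_alg_Alg:
  assumes small: "\<And>s. s \<in> S \<Longrightarrow> small (ccar D s)"
    and closed: "\<forall>\<sigma>\<in>syms \<Sigma>. \<forall>p\<in>Und C (par \<Sigma> \<sigma>). \<forall>xs.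
      list_all2 (\<lambda>x s. x \<in> ccar D s) xs (ins \<Sigma> \<sigma>) \<longrightarrow> copn D (\<sigma>, p) xs \<in> ccar D (out \<Sigma> \<sigma>)"
  shows "indisc_alg C S \<Sigma> D \<in> Alg C S \<Sigma>"
    and "\<And>s. s \<in> S \<Longrightarrow> Und C (car (indisc_alg C S \<Sigma> D) s) = ccar D s"
    and "\<And>\<sigma> p xs. \<sigma> \<in> syms \<Sigma> \<Longrightarrow> p \<in> Und C (par \<Sigma> \<sigma>) \<Longrightarrow>
      list_all2 (\<lambda>x s. x \<in> ccar D s) xs (ins \<Sigma> \<sigma>) \<Longrightarrow>
      opn (indisc_alg C S \<Sigma> D) \<sigma> (tuple [p, tuple xs]) = copn D (\<sigma>, p) xs"
    and "\<And>s W h. s \<in> S \<Longrightarrow> W \<in> Ob C \<Longrightarrow> h \<in> Und C W \<rightarrow> ccar D s \<Longrightarrow>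
      adm C W (car (indisc_alg C S \<Sigma> D) s) h"
proof -
  define A where "A = (\<lambda>s\<in>S. Indisc C (ccar D s))"
  have car: "car (indisc_alg C S \<Sigma> D) = A"
    by (simp add: indisc_alg_def Let_def A_def)
  have A: "A \<in> pow_Ob C S"
    using Indisc_adm(1)[OF small] by (simp add: pow_Ob_def A_def)
  have Und: "Und C (A s) = ccar D s" if "s \<in> S" for s
    using Indisc_adm(2)[OF small] that by (simp add: A_def)
  then show "\<And>s. s \<in> S \<Longrightarrow> Und C (car (indisc_alg C S \<Sigma> D) s) = ccar D s"
    by (simp add: car)
  have adm: "adm C W (A s) h" if "s \<in> S" "W \<in> Ob C" "h \<in> Und C W \<rightarrow> ccar D s" for s W h
    using Indisc_adm(3)[OF small] that by (simp add: A_def)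
  then show "\<And>s W h. s \<in> S \<Longrightarrow> W \<in> Ob C \<Longrightarrow> h \<in> Und C W \<rightarrow> ccar D s \<Longrightarrow>
      adm C W (car (indisc_alg C S \<Sigma> D) s) h"
    by (simp add: car)
  have args: "args A (ins \<Sigma> \<sigma>) xs \<longleftrightarrow> list_all2 (\<lambda>x s. x \<in> ccar D s) xs (ins \<Sigma> \<sigma>)"
    if "\<sigma> \<in> syms \<Sigma>" for \<sigma> xs
    using signature_sorts(1)[OF that] Und by (auto simp: args_def list_all2_conv_all_nth subset_iff)
  let ?f = "\<lambda>\<sigma> z. copn D (\<sigma>, untuple z ! 0) (untuple (untuple z ! 1))"
  have opn: "opn (indisc_alg C S \<Sigma> D) =
      (\<lambda>\<sigma>\<in>syms \<Sigma>. \<lambda>z\<in>Und C (dom_Ob C (par \<Sigma> \<sigma>) (ins \<Sigma> \<sigma>) A). ?f \<sigma> z)"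
    by (simp add: indisc_alg_def Let_def A_def)
  show "opn (indisc_alg C S \<Sigma> D) \<sigma> (tuple [p, tuple xs]) = copn D (\<sigma>, p) xs"
    if \<sigma>: "\<sigma> \<in> syms \<Sigma>" and "p \<in> Und C (par \<Sigma> \<sigma>)" "list_all2 (\<lambda>x s. x \<in> ccar D s) xs (ins \<Sigma> \<sigma>)"
    for \<sigma> p xs
    using that Und_dom_Ob[OF A signature_sorts(1,3)[OF \<sigma>]] args[OF \<sigma>] by (simp add: opn)
  have "restrict (?f \<sigma>) (Und C (dom_Ob C (par \<Sigma> \<sigma>) (ins \<Sigma> \<sigma>) A)) \<in>
      Hom C (dom_Ob C (par \<Sigma> \<sigma>) (ins \<Sigma> \<sigma>) A) (A (out \<Sigma> \<sigma>))" if \<sigma>: "\<sigma> \<in> syms \<Sigma>" for \<sigma>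
  proof (rule adm_restrict_Hom[OF adm[OF signature_sorts(2)[OF \<sigma>] dom_Ob_Ob[OF A signature_sorts(1,3)[OF \<sigma>]]]], rule funcsetI)
    fix z assume z: "z \<in> Und C (dom_Ob C (par \<Sigma> \<sigma>) (ins \<Sigma> \<sigma>) A)"
    obtain p xs where "z = tuple [p, tuple xs]" "p \<in> Und C (par \<Sigma> \<sigma>)" "args A (ins \<Sigma> \<sigma>) xs"
      by (rule dom_Ob_cases[OF z A signature_sorts(1,3)[OF \<sigma>]])
    then show "?f \<sigma> z \<in> ccar D (out \<Sigma> \<sigma>)"
      using closed \<sigma> args[OF \<sigma>] by simp
  qed
  then show "indisc_alg C S \<Sigma> D \<in> Alg C S \<Sigma>"
    unfolding Alg_def using A by (simp add: car opn)
qed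

lemma und_sig_simps [simp]:
  "syms (und_sig C \<Sigma>) = (SIGMA \<sigma>:syms \<Sigma>. Und C (par \<Sigma> \<sigma>))"
  "ins (und_sig C \<Sigma>) (\<sigma>, p) = ins \<Sigma> \<sigma>" "out (und_sig C \<Sigma>) (\<sigma>, p) = out \<Sigma> \<sigma>"
  by (simp_all add: und_sig_def)

text \<open>A symbol of the underlying signature pairs a symbol with a point of a small set. This is
  the hypothesis of \<open>enc_terms\<close>.\<close>

lemma small_sized_und_sig: "small_sized TYPE('u) (syms (und_sig C \<Sigma>))"
  unfolding und_sig_simps
  by (rule small_sized_Sigma) (use signature small_Und signature_sorts(3) in \<open>auto simp: is_enriched_signature_def\<close>)

lemma eval_in:
  assumes A: "A \<in> Alg C S \<Sigma>" and "distinct vs" and xs: "args (car A) (map snd vs) xs"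
    and t: "wt (und_sig C \<Sigma>) vs t s"
  shows "eval (und_alg C A) vs xs t \<in> Und C (car A s)"
  using t
proof (induction rule: wt.induct)
  case (wt_Var x)
  then obtain i where i: "i < length vs" "x = vs ! i"
    by (metis in_set_conv_nth)
  have "length vs = length xs" "xs ! i \<in> Und C (car A (map snd vs ! i))"
    using xs i by (auto simp: args_def list_all2_conv_all_nth)
  \<comment> \<open>As \<open>vs\<close> is distinct, looking up its \<open>i\<close>-th variable
    returns the \<open>i\<close>-th argument.\<close>
  moreover from this have "map_of (zip vs xs) x = Some (xs ! i)"
    using i assms(2) by (simp add: map_of_zip_nth)
  ultimately show ?case
    using i by simp
next
  case (wt_App f ts)
  obtain \<sigma> p where f: "f = (\<sigma>, p)" "\<sigma> \<in> syms \<Sigma>" "p \<in> Und C (par \<Sigma> \<sigma>)"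
    using wt_App(1) by auto
  have "args (car A) (ins \<Sigma> \<sigma>) (map (eval (und_alg C A) vs xs) ts)"
    using wt_App(2) f by (auto simp: args_def list_all2_conv_all_nth)
  then show ?case
    using Alg_opn_in[OF A f(2,3)] f by (simp add: und_alg_def)
qed

(* Both functions A -> A^Indisc (the identity) and terms -> A^Indisc (evaluation at xs) are
   algebra morphisms; naturality along them identifies omega_A with evaluation of its term. *)
lemma eval_op_term:
  assumes \<omega>: "algebraic_operation C S \<Sigma> \<omega>" and A: "A \<in> Alg C S \<Sigma>" and p: "p \<in> Und C (op_par \<omega>)"
    and vs: "distinct vs" "map snd vs = op_ins \<omega>" and xs: "args (car A) (op_ins \<omega>) xs"
  shows "eval (und_alg C A) vs xs (op_term C S \<Sigma> \<omega> p vs) = component \<omega> A (tuple [p, tuple xs])"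
proof -
  let ?\<Gamma> = "und_sig C \<Sigma>"
  let ?D = "coded_term_algebra ?\<Gamma> vs :: (_, _, 'u) classical_algebra"
  let ?enc = "enc ?\<Gamma> vs :: _ \<Rightarrow> 'u" and ?dec = "dec ?\<Gamma> vs :: 'u \<Rightarrow> _"
  let ?T = "indisc_alg C S \<Sigma> ?D" and ?B = "indisc_alg C S \<Sigma> (und_alg C A)"
  let ?eval = "eval (und_alg C A) vs xs"
  have \<omega>_sig: "set (op_ins \<omega>) \<subseteq> S" "op_out \<omega> \<in> S"
    using \<omega> by (auto simp: algebraic_operation_def)
  \<comment> \<open>Decoding is reliable on well-typed terms, the set on which \<open>enc\<close> is
    injective.\<close>
  have dec_enc: "?dec (?enc t) = t" if "wt ?\<Gamma> vs t s" for t s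
    using enc_terms(1)[OF small_sized_und_sig] wt_terms[OF that] by (simp add: dec_def)
  have ccar: "ccar ?D s = ?enc ` {t. wt ?\<Gamma> vs t s}" for s
    by (simp add: coded_term_algebra_def term_algebra_def)
  have copn: "copn ?D f ys = ?enc (App f (map ?dec ys))" for f ys
    by (simp add: coded_term_algebra_def term_algebra_def)
  have dec_args: "list_all2 (wt ?\<Gamma> vs) (map ?dec ys) ss"
    if "list_all2 (\<lambda>x s. x \<in> ccar ?D s) ys ss" for ys ss
    using that dec_enc by (fastforce simp: list_all2_conv_all_nth ccar)
  have small_T: "small (ccar ?D s)" for s
    using enc_terms(2)[OF small_sized_und_sig, of vs]
    by (rule small_subset) (auto simp: ccar dest: wt_terms)
  have wt_App: "wt ?\<Gamma> vs (App (\<sigma>, p) (map ?dec ys)) (out \<Sigma> \<sigma>)"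
    if "\<sigma> \<in> syms \<Sigma>" "p \<in> Und C (par \<Sigma> \<sigma>)" "list_all2 (\<lambda>x s. x \<in> ccar ?D s) ys (ins \<Sigma> \<sigma>)" for \<sigma> p ys
    using that dec_args wt.wt_App[of "(\<sigma>, p)" ?\<Gamma> vs] by simp
  have "\<forall>\<sigma>\<in>syms \<Sigma>. \<forall>p\<in>Und C (par \<Sigma> \<sigma>). \<forall>ys.
      list_all2 (\<lambda>x s. x \<in> ccar ?D s) ys (ins \<Sigma> \<sigma>) \<longrightarrow> copn ?D (\<sigma>, p) ys \<in> ccar ?D (out \<Sigma> \<sigma>)"
  proof (intro ballI allI impI)
    fix \<sigma> p ys
    assume "\<sigma> \<in> syms \<Sigma>" "p \<in> Und C (par \<Sigma> \<sigma>)" "list_all2 (\<lambda>x s. x \<in> ccar ?D s) ys (ins \<Sigma> \<sigma>)"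
    from wt_App[OF this] show "copn ?D (\<sigma>, p) ys \<in> ccar ?D (out \<Sigma> \<sigma>)"
      unfolding copn unfolding ccar by (intro imageI CollectI)
  qed
  note T = indisc_alg_Alg[of ?D, OF small_T this]
  have ccar_A: "ccar (und_alg C A) s = Und C (car A s)" for s
    by (simp add: und_alg_def)
  have copn_A: "copn (und_alg C A) (\<sigma>, p) ys = opn A \<sigma> (tuple [p, tuple ys])" for \<sigma> p ys
    by (simp add: und_alg_def)
  have "small (ccar (und_alg C A) s)" if "s \<in> S" for s
    using small_Und pow_Ob_in[OF Alg_car[OF A] that] by (simp add: ccar_A)
  moreover have "copn (und_alg C A) (\<sigma>, p) ys \<in> ccar (und_alg C A) (out \<Sigma> \<sigma>)"
    if "\<sigma> \<in> syms \<Sigma>" "p \<in> Und C (par \<Sigma> \<sigma>)" "list_all2 (\<lambda>x s. x \<in> ccar (und_alg C A) s) ys (ins \<Sigma> \<sigma>)"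
    for \<sigma> p ys
    using Alg_opn_in[OF A that(1,2)] that(3) by (simp add: ccar_A copn_A args_def)
  ultimately have B: "?B \<in> Alg C S \<Sigma>" "\<And>s. s \<in> S \<Longrightarrow> Und C (car ?B s) = Und C (car A s)"
    "\<And>\<sigma> p ys. \<sigma> \<in> syms \<Sigma> \<Longrightarrow> p \<in> Und C (par \<Sigma> \<sigma>) \<Longrightarrow> args (car A) (ins \<Sigma> \<sigma>) ys \<Longrightarrow>
      opn ?B \<sigma> (tuple [p, tuple ys]) = opn A \<sigma> (tuple [p, tuple ys])"
    "\<And>s W h. s \<in> S \<Longrightarrow> W \<in> Ob C \<Longrightarrow> h \<in> Und C W \<rightarrow> Und C (car A s) \<Longrightarrow> adm C W (car ?B s) h"
    using indisc_alg_Alg[of "und_alg C A"] by (simp_all add: ccar_A copn_A args_def)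
  \<comment> \<open>The identity into the indiscrete copy, restricted on both levels because
    morphisms are extensional.\<close>
  define i where "i = (\<lambda>s\<in>S. \<lambda>x\<in>Und C (car A s). x)"
  have i: "i s x = x" if "s \<in> S" "x \<in> Und C (car A s)" for s x
    using that by (simp add: i_def)
  have i_map2: "map2 i ss ys = ys" if "set ss \<subseteq> S" "args (car A) ss ys" for ss ys
    using that i by (auto simp: args_def list_all2_conv_all_nth subset_iff intro!: nth_equalityI)
  have "i \<in> pow_Hom C S (car A) (car ?B)"
    unfolding i_def using Alg_car A B pow_Ob_in by (intro restrict_pow_Hom) auto
  then have i_Hom: "i \<in> alg_Hom C S \<Sigma> A ?B"
    unfolding alg_Hom_iff[OF A] using Alg_opn_in[OF A] signature_sorts(1,2) B(3) i i_map2 by simp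
  have "component \<omega> A (tuple [p, tuple xs]) = i (op_out \<omega>) (component \<omega> A (tuple [p, tuple xs]))"
    using algebraic_operation_in[OF \<omega> A p xs] \<omega>_sig i by simp
  also have "\<dots> = component \<omega> ?B (tuple [p, tuple xs])"
    using algebraic_operation_natural[OF \<omega> A B(1) i_Hom p xs] i_map2[OF \<omega>_sig(1) xs] by simp
  finally have 1: "component \<omega> A (tuple [p, tuple xs]) = component \<omega> ?B (tuple [p, tuple xs])" .

  define e where "e = (\<lambda>s\<in>S. \<lambda>x\<in>Und C (car ?T s). ?eval (?dec x))"
  have e: "e s x = ?eval (?dec x)" if "s \<in> S" "x \<in> Und C (car ?T s)" for s x
    using that by (simp add: e_def)
  have xs': "args (car A) (map snd vs) xs"
    using xs vs(2) by simp
  have args_T: "args (car ?T) ss ys \<longleftrightarrow> list_all2 (\<lambda>x s. x \<in> ccar ?D s) ys ss" if "set ss \<subseteq> S" for ss ys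
    using that T(2) by (auto simp: args_def list_all2_conv_all_nth subset_iff)
  have e_map2: "map2 e ss ys = map ?eval (map ?dec ys)" if "set ss \<subseteq> S" "args (car ?T) ss ys" for ss ys
    using that e by (auto simp: args_def list_all2_conv_all_nth subset_iff intro!: nth_equalityI)
  have "e \<in> pow_Hom C S (car ?T) (car ?B)"
    unfolding e_def
  proof (rule restrict_pow_Hom[OF Alg_car[OF T(1)] Alg_car[OF B(1)]])
    fix s assume s: "s \<in> S"
    \<comment> \<open>Only the sort of the value has to be checked; admissibility is automatic for
      an indiscrete codomain.\<close>
    have "?eval (?dec x) \<in> Und C (car A s)" if "x \<in> ccar ?D s" for x
      using that eval_in[OF A vs(1) xs'] dec_enc by (auto simp: ccar)
    then show "adm C (car ?T s) (car ?B s) (\<lambda>x. ?eval (?dec x))"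
      using B(4)[OF s pow_Ob_in[OF Alg_car[OF T(1)] s]] T(2)[OF s] by auto
  qed
  moreover have "e (out \<Sigma> \<sigma>) (opn ?T \<sigma> (tuple [p, tuple ys])) =
      opn ?B \<sigma> (tuple [p, tuple (map2 e (ins \<Sigma> \<sigma>) ys)])"
    if \<sigma>: "\<sigma> \<in> syms \<Sigma>" and p: "p \<in> Und C (par \<Sigma> \<sigma>)" and ys: "args (car ?T) (ins \<Sigma> \<sigma>) ys" for \<sigma> p ys
  proof -
    have ys': "list_all2 (\<lambda>x s. x \<in> ccar ?D s) ys (ins \<Sigma> \<sigma>)"
      using ys args_T signature_sorts(1)[OF \<sigma>] by blast
    have opn_T: "opn ?T \<sigma> (tuple [p, tuple ys]) = ?enc (App (\<sigma>, p) (map ?dec ys))"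
      using T(3)[OF \<sigma> p ys'] by (simp add: copn)
    have "args (car A) (ins \<Sigma> \<sigma>) (map ?eval (map ?dec ys))"
      using dec_args[OF ys'] eval_in[OF A vs(1) xs'] by (auto simp: args_def list_all2_conv_all_nth)
    then have "opn ?B \<sigma> (tuple [p, tuple (map2 e (ins \<Sigma> \<sigma>) ys)]) = ?eval (App (\<sigma>, p) (map ?dec ys))"
      using B(3)[OF \<sigma> p] e_map2[OF signature_sorts(1)[OF \<sigma>] ys] by (simp add: copn_A)
    also have "\<dots> = ?eval (?dec (opn ?T \<sigma> (tuple [p, tuple ys])))"
      using dec_enc[OF wt_App[OF \<sigma> p ys']] by (simp only: opn_T)
    also have "\<dots> = e (out \<Sigma> \<sigma>) (opn ?T \<sigma> (tuple [p, tuple ys]))"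
      using Alg_opn_in[OF T(1) \<sigma> p ys] signature_sorts(2)[OF \<sigma>] e by simp
    finally show ?thesis
      by simp
  qed
  ultimately have e_Hom: "e \<in> alg_Hom C S \<Sigma> ?T ?B"
    unfolding alg_Hom_iff[OF T(1)] by blast
  \<comment> \<open>The generic argument list: \<open>e\<close> sends it to \<open>xs\<close>, and
    \<open>op_term\<close> is by definition the decoded value of the component there.\<close>
  let ?vars = "map (\<lambda>x. ?enc (Var x)) vs"
  have len: "length vs = length (op_ins \<omega>)" "length xs = length vs"
    using arg_cong[OF vs(2), of length] xs by (auto simp: args_def dest: list_all2_lengthD)
  have wt_vars: "wt ?\<Gamma> vs (Var (vs ! i)) (op_ins \<omega> ! i)" if "i < length vs" for i
    using wt.wt_Var[OF nth_mem[OF that], of ?\<Gamma>] nth_map[OF that, of snd] vs(2) by simp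
  have vars: "args (car ?T) (op_ins \<omega>) ?vars"
    unfolding args_T[OF \<omega>_sig(1)] using wt_vars len by (auto simp: list_all2_conv_all_nth ccar)
  have "map ?eval (map ?dec ?vars) = xs"
    using dec_enc[OF wt_vars] len vs(1) by (intro nth_equalityI) (simp_all add: map_of_zip_nth)
  then have "component \<omega> ?B (tuple [p, tuple xs]) = e (op_out \<omega>) (component \<omega> ?T (tuple [p, tuple ?vars]))"
    using algebraic_operation_natural[OF \<omega> T(1) B(1) e_Hom p vars] e_map2[OF \<omega>_sig(1) vars] by simp
  also have "\<dots> = ?eval (?dec (component \<omega> ?T (tuple [p, tuple ?vars])))"
    using algebraic_operation_in[OF \<omega> T(1) p vars] \<omega>_sig e by simp
  finally show ?thesis
    using 1 by (simp add: op_term_def Let_def)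
qed

end


section \<open>Quotient algebras\<close>

lemma class_code_in: "K \<noteq> {} \<Longrightarrow> class_code K \<in> K"
  unfolding class_code_def by (rule some_in_eq[THEN iffD2])

context enriched_algebras
begin

lemma args_listset: "xs \<in> listset (map (\<lambda>s. Und C (A s)) ss) \<longleftrightarrow> args A ss xs"
  by (simp add: args_def listset_iff_list_all2 list_all2_map2)

text \<open>Preimages are chosen entry by entry. Identities about a quotient can then be checked on
  lists of elements of the original algebra.\<close>

lemma args_surj:
  assumes "args B ss ys" "\<And>s. s \<in> set ss \<Longrightarrow> q s ` Und C (A s) = Und C (B s)"
  obtains xs where "args A ss xs" "map2 q ss xs = ys"
proof -
  have "list_all2 (\<lambda>y s. y \<in> q s ` Und C (A s)) ys ss"
    using assms unfolding args_def by (auto simp: list_all2_conv_all_nth)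
  then have "\<exists>xs. args A ss xs \<and> map2 q ss xs = ys"
  proof (induction rule: list_all2_induct)
    case Nil
    then show ?case
      by (simp add: args_def)
  next
    case (Cons y ys s ss)
    obtain x where "x \<in> Und C (A s)" "y = q s x"
      using Cons.hyps(1) by auto
    moreover obtain xs where "args A ss xs" "map2 q ss xs = ys"
      using Cons.IH by auto
    ultimately have "args A (s # ss) (x # xs)" "map2 q (s # ss) (x # xs) = y # ys"
      by (simp_all add: args_def)
    then show ?case
      by (intro exI[of _ "x # xs"] conjI)
  qed
  then show thesis
    by (elim exE conjE) (rule that)
qed

section \<open>Composition in the power category and of algebra morphisms\<close>

lemma pow_comp_pow_Hom:
  assumes "f \<in> pow_Hom C S X Y" "h \<in> pow_Hom C S Y Z" "X \<in> pow_Ob C S" "Y \<in> pow_Ob C S" "Z \<in> pow_Ob C S"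
  shows "pow_comp C S X h f \<in> pow_Hom C S X Z"
  unfolding pow_comp_def compose_def
  by (rule restrict_pow_Hom[OF assms(3,5)
      adm_comp[OF pow_Hom_adm[OF assms(1,3,4)] pow_Hom_adm[OF assms(2,4,5)]]])

lemma pow_comp_app:
  "s \<in> S \<Longrightarrow> x \<in> Und C (X s) \<Longrightarrow> pow_comp C S X h f s x = h s (f s x)"
  by (simp add: pow_comp_def compose_eq)

lemma pow_Hom_in:
  assumes "f \<in> pow_Hom C S A B" "A \<in> pow_Ob C S" "B \<in> pow_Ob C S" "s \<in> S" "x \<in> Und C (A s)"
  shows "f s x \<in> Und C (B s)"
  using adm_in[OF pow_Hom_adm[OF assms(1-4)] assms(5)] .

lemma pow_comp_assoc:
  assumes "f \<in> pow_Hom C S X Y" "X \<in> pow_Ob C S" "Y \<in> pow_Ob C S"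
  shows "pow_comp C S X k (pow_comp C S X h f) = pow_comp C S X (pow_comp C S Y k h) f"
  unfolding pow_comp_def using pow_Hom_in[OF assms]
  by (intro restrict_ext) (simp add: compose_def restrict_def fun_eq_iff)

lemma map2_pow_comp:
  assumes "args X ss xs" "set ss \<subseteq> S"
  shows "map2 (pow_comp C S X h f) ss xs = map2 h ss (map2 f ss xs)"
  using assms pow_comp_app
  by (intro nth_equalityI) (auto simp: args_def list_all2_conv_all_nth subset_iff)

lemma alg_Hom_comp:
  assumes A: "A \<in> Alg C S \<Sigma>" and B: "B \<in> Alg C S \<Sigma>" and D: "D \<in> Alg C S \<Sigma>"
    and f: "f \<in> alg_Hom C S \<Sigma> A B" and h: "h \<in> alg_Hom C S \<Sigma> B D"
  shows "pow_comp C S (car A) h f \<in> alg_Hom C S \<Sigma> A D"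
  unfolding alg_Hom_iff[OF A]
proof (intro conjI ballI allI impI)
  note cars = Alg_car[OF A] Alg_car[OF B] Alg_car[OF D]
  show "pow_comp C S (car A) h f \<in> pow_Hom C S (car A) (car D)"
    by (rule pow_comp_pow_Hom[OF alg_Hom_pow_Hom[OF f] alg_Hom_pow_Hom[OF h] cars])
  fix \<sigma> p xs
  assume \<sigma>: "\<sigma> \<in> syms \<Sigma>" and p: "p \<in> Und C (par \<Sigma> \<sigma>)" and xs: "args (car A) (ins \<Sigma> \<sigma>) xs"
  have "args (car B) (ins \<Sigma> \<sigma>) (map2 f (ins \<Sigma> \<sigma>) xs)"
    using args_map2[OF xs] pow_Hom_in[OF alg_Hom_pow_Hom[OF f] cars(1,2)] signature_sorts(1)[OF \<sigma>] by blast
  then have "h (out \<Sigma> \<sigma>) (f (out \<Sigma> \<sigma>) (opn A \<sigma> (tuple [p, tuple xs]))) =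
      opn D \<sigma> (tuple [p, tuple (map2 h (ins \<Sigma> \<sigma>) (map2 f (ins \<Sigma> \<sigma>) xs))])"
    using f h \<sigma> p xs unfolding alg_Hom_iff[OF A] alg_Hom_iff[OF B] by simp
  then show "pow_comp C S (car A) h f (out \<Sigma> \<sigma>) (opn A \<sigma> (tuple [p, tuple xs])) =
      opn D \<sigma> (tuple [p, tuple (map2 (pow_comp C S (car A) h f) (ins \<Sigma> \<sigma>) xs)])"
    unfolding map2_pow_comp[OF xs signature_sorts(1)[OF \<sigma>]]
    using Alg_opn_in[OF A \<sigma> p xs] signature_sorts(2)[OF \<sigma>] by (simp add: pow_comp_app)
qed

section \<open>The quotient by a congruence and its universal property\<close>

lemma congruence_equiv: "congruence C S \<Sigma> A R \<Longrightarrow> s \<in> S \<Longrightarrow> equiv (Und C (car A s)) (R s)"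
  by (simp add: congruence_def)

lemma congruence_opn:
  assumes "congruence C S \<Sigma> A R" "\<sigma> \<in> syms \<Sigma>" "p \<in> Und C (par \<Sigma> \<sigma>)"
    "length as = length (ins \<Sigma> \<sigma>)" "length bs = length (ins \<Sigma> \<sigma>)"
    "\<And>i. i < length (ins \<Sigma> \<sigma>) \<Longrightarrow> (as ! i, bs ! i) \<in> R (ins \<Sigma> \<sigma> ! i)"
  shows "(opn A \<sigma> (tuple [p, tuple as]), opn A \<sigma> (tuple [p, tuple bs])) \<in> R (out \<Sigma> \<sigma>)"
  by (rule assms(1)[unfolded congruence_def, THEN conjunct2, rule_format, OF assms(2-6)])

text \<open>The code of a class is one of its members, so equal codes give two classes a common
  element.\<close>

lemma quot_map_eq_iff:
  assumes R: "congruence C S \<Sigma> A R" and s: "s \<in> S" and a: "a \<in> Und C (car A s)" and b: "b \<in> Und C (car A s)"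
  shows "quot_map C S A R s a = quot_map C S A R s b \<longleftrightarrow> (a, b) \<in> R s"
proof -
  note eq = congruence_equiv[OF R s]
  have code: "(x, class_code (R s `` {x})) \<in> R s" if "x \<in> Und C (car A s)" for x
    using class_code_in[of "R s `` {x}"] equiv_class_self[OF eq that] by blast
  have "(a, b) \<in> R s" if "class_code (R s `` {a}) = class_code (R s `` {b})"
    using code[OF a] code[OF b] that eq by (metis equivE symE transE)
  moreover have "R s `` {a} = R s `` {b}" if "(a, b) \<in> R s"
    by (rule equiv_class_eq[OF eq that])
  ultimately show ?thesis
    using s a b by (auto simp: quot_map_def)
qed

lemma quotient_map_quot_map:
  assumes A: "A \<in> Alg C S \<Sigma>" and s: "s \<in> S"
  shows "quotient_map C (car A s) (car (quot_alg C S \<Sigma> A R) s) (quot_map C S A R s)"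
proof -
  let ?Y = "class_code ` (Und C (car A s) // R s)"
  have Ob: "car A s \<in> Ob C"
    using pow_Ob_in[OF Alg_car[OF A] s] .
  \<comment> \<open>The codes of classes are the values of the quotient map, so they form a small
    set.\<close>
  have img: "quot_map C S A R s ` Und C (car A s) = ?Y"
    using s by (auto simp: quot_map_def quotient_def)
  moreover have "small ?Y"
    using small_image[OF small_Und[OF Ob]] unfolding img[symmetric] .
  moreover have "quot_map C S A R s \<in> extensional (Und C (car A s))"
    using s by (simp add: quot_map_def)
  moreover have "car (quot_alg C S \<Sigma> A R) s = final_structure C ?Y {(car A s, quot_map C S A R s)}"
    using s by (simp add: quot_alg_def Let_def)
  ultimately show ?thesis
    using quotient_map_final_structure Ob by simp
qed

text \<open>Evaluates the \<open>THE\<close> in \<open>quot_alg\<close>; uniqueness of the value is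
  the congruence property. Taking \<open>Q\<close> as an assumption makes the rule available while
  the quotient is still being shown to be an algebra.\<close>

lemma quot_alg_opn:
  assumes A: "A \<in> Alg C S \<Sigma>" and R: "congruence C S \<Sigma> A R" and \<sigma>: "\<sigma> \<in> syms \<Sigma>"
    and p: "p \<in> Und C (par \<Sigma> \<sigma>)" and as: "args (car A) (ins \<Sigma> \<sigma>) as"
    and Q: "car (quot_alg C S \<Sigma> A R) \<in> pow_Ob C S"
  shows "opn (quot_alg C S \<Sigma> A R) \<sigma> (tuple [p, tuple (map2 (quot_map C S A R) (ins \<Sigma> \<sigma>) as)]) =
    quot_map C S A R (out \<Sigma> \<sigma>) (opn A \<sigma> (tuple [p, tuple as]))"
proof -
  define q where "q = quot_map C S A R"
  let ?Q = "car (quot_alg C S \<Sigma> A R)"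
  let ?z = "tuple [p, tuple (map2 q (ins \<Sigma> \<sigma>) as)]"
  have "args ?Q (ins \<Sigma> \<sigma>) (map2 q (ins \<Sigma> \<sigma>) as)"
    using args_map2[OF as] adm_in[OF quotient_mapD(1)[OF quotient_map_quot_map[OF A]]] signature_sorts(1)[OF \<sigma>]
    unfolding q_def by blast
  then have z: "?z \<in> Und C (dom_Ob C (par \<Sigma> \<sigma>) (ins \<Sigma> \<sigma>) ?Q)"
    using Und_dom_Ob[OF Q signature_sorts(1,3)[OF \<sigma>]] p by simp
  have car: "?Q = (\<lambda>s\<in>S. final_structure C (class_code ` (Und C (car A s) // R s)) {(car A s, q s)})"
    by (simp add: quot_alg_def Let_def q_def)
  have opn: "opn (quot_alg C S \<Sigma> A R) \<sigma> ?z = (THE c. \<exists>p\<in>Und C (par \<Sigma> \<sigma>).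
      \<exists>as\<in>listset (map (\<lambda>s. Und C (car A s)) (ins \<Sigma> \<sigma>)).
        ?z = tuple [p, tuple (map2 q (ins \<Sigma> \<sigma>) as)] \<and> c = q (out \<Sigma> \<sigma>) (opn A \<sigma> (tuple [p, tuple as])))"
    using z \<sigma> unfolding car by (simp add: quot_alg_def Let_def flip: q_def)
  have "opn (quot_alg C S \<Sigma> A R) \<sigma> ?z = q (out \<Sigma> \<sigma>) (opn A \<sigma> (tuple [p, tuple as]))"
    unfolding opn
  proof (rule the_equality)
    show "\<exists>p'\<in>Und C (par \<Sigma> \<sigma>). \<exists>as'\<in>listset (map (\<lambda>s. Und C (car A s)) (ins \<Sigma> \<sigma>)).
        ?z = tuple [p', tuple (map2 q (ins \<Sigma> \<sigma>) as')] \<and>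
        q (out \<Sigma> \<sigma>) (opn A \<sigma> (tuple [p, tuple as])) = q (out \<Sigma> \<sigma>) (opn A \<sigma> (tuple [p', tuple as']))"
      using p as args_listset by blast
    fix c
    assume "\<exists>p'\<in>Und C (par \<Sigma> \<sigma>). \<exists>as'\<in>listset (map (\<lambda>s. Und C (car A s)) (ins \<Sigma> \<sigma>)).
        ?z = tuple [p', tuple (map2 q (ins \<Sigma> \<sigma>) as')] \<and> c = q (out \<Sigma> \<sigma>) (opn A \<sigma> (tuple [p', tuple as']))"
    \<comment> \<open>\<open>tuple\<close> is injective, so the parameter read off from
      \<open>?z\<close> is \<open>p\<close> itself. Only the arguments can differ, as in the
      congruence property.\<close>
    then obtain bs where bs: "args (car A) (ins \<Sigma> \<sigma>) bs" "map2 q (ins \<Sigma> \<sigma>) as = map2 q (ins \<Sigma> \<sigma>) bs"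
      and c: "c = q (out \<Sigma> \<sigma>) (opn A \<sigma> (tuple [p, tuple bs]))"
      by (auto simp: args_listset)
    have len: "length as = length (ins \<Sigma> \<sigma>)" "length bs = length (ins \<Sigma> \<sigma>)"
      using as bs(1) by (simp_all add: args_def list_all2_lengthD)
    have "(as ! i, bs ! i) \<in> R (ins \<Sigma> \<sigma> ! i)" if i: "i < length (ins \<Sigma> \<sigma>)" for i
    proof -
      have "q (ins \<Sigma> \<sigma> ! i) (as ! i) = q (ins \<Sigma> \<sigma> ! i) (bs ! i)"
        using arg_cong[OF bs(2), of "\<lambda>xs. xs ! i"] len i by simp
      moreover have "ins \<Sigma> \<sigma> ! i \<in> S"
        using signature_sorts(1)[OF \<sigma>] i nth_mem by blast
      moreover have "as ! i \<in> Und C (car A (ins \<Sigma> \<sigma> ! i))" "bs ! i \<in> Und C (car A (ins \<Sigma> \<sigma> ! i))"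
        using as bs(1) i by (auto simp: args_def list_all2_conv_all_nth)
      ultimately show ?thesis
        using quot_map_eq_iff[OF R] by (simp add: q_def)
    qed
    then have "(opn A \<sigma> (tuple [p, tuple as]), opn A \<sigma> (tuple [p, tuple bs])) \<in> R (out \<Sigma> \<sigma>)"
      by (rule congruence_opn[OF R \<sigma> p len])
    then have "q (out \<Sigma> \<sigma>) (opn A \<sigma> (tuple [p, tuple as])) = q (out \<Sigma> \<sigma>) (opn A \<sigma> (tuple [p, tuple bs]))"
      using quot_map_eq_iff[OF R signature_sorts(2)[OF \<sigma>]] Alg_opn_in[OF A \<sigma> p] as bs(1) by (simp add: q_def)
    then show "c = q (out \<Sigma> \<sigma>) (opn A \<sigma> (tuple [p, tuple as]))"
      using c by simp
  qed
  then show ?thesis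
    by (simp add: q_def)
qed

lemma quot_alg:
  assumes A: "A \<in> Alg C S \<Sigma>" and R: "congruence C S \<Sigma> A R"
  shows "quot_alg C S \<Sigma> A R \<in> Alg C S \<Sigma>"
    and "quot_map C S A R \<in> alg_Hom C S \<Sigma> A (quot_alg C S \<Sigma> A R)"
proof -
  let ?Q = "quot_alg C S \<Sigma> A R" and ?q = "quot_map C S A R"
  note q = quotient_map_quot_map[OF A, of _ R]
  have Q: "car ?Q \<in> pow_Ob C S"
    unfolding pow_Ob_def
  proof (rule PiE_I)
    show "car ?Q s \<in> Ob C" if "s \<in> S" for s
      using adm_Ob(2)[OF quotient_mapD(1)[OF q[OF that]]] .
    show "car ?Q s = undefined" if "s \<notin> S" for s
      using that by (simp add: quot_alg_def Let_def)
  qed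
  have "opn ?Q \<sigma> \<in> Hom C (dom_Ob C (par \<Sigma> \<sigma>) (ins \<Sigma> \<sigma>) (car ?Q)) (car ?Q (out \<Sigma> \<sigma>))"
    if \<sigma>: "\<sigma> \<in> syms \<Sigma>" for \<sigma>
  proof -
    note Ob = signature_sorts(1,3)[OF \<sigma>]
    \<comment> \<open>Along \<open>?r\<close> the operation of the quotient becomes
      \<open>opn A \<sigma>\<close> followed by the quotient map, which is admissible; as
      \<open>?r\<close> is a quotient map, the operation itself is admissible.\<close>
    let ?r = "\<lambda>x. tuple [untuple x ! 0, tuple (map2 ?q (ins \<Sigma> \<sigma>) (untuple (untuple x ! 1)))]"
    have "opn A \<sigma> \<in> Hom C (dom_Ob C (par \<Sigma> \<sigma>) (ins \<Sigma> \<sigma>) (car A)) (car A (out \<Sigma> \<sigma>))"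
      using A \<sigma> by (auto simp: Alg_def)
    then have "adm C (dom_Ob C (par \<Sigma> \<sigma>) (ins \<Sigma> \<sigma>) (car A)) (car A (out \<Sigma> \<sigma>)) (opn A \<sigma>)"
      using Hom_iff_adm[OF dom_Ob_Ob[OF Alg_car[OF A] Ob] pow_Ob_in[OF Alg_car[OF A] signature_sorts(2)[OF \<sigma>]]]
      by blast
    then have "adm C (dom_Ob C (par \<Sigma> \<sigma>) (ins \<Sigma> \<sigma>) (car A)) (car ?Q (out \<Sigma> \<sigma>))
        (\<lambda>x. ?q (out \<Sigma> \<sigma>) (opn A \<sigma> x))"
      by (rule adm_comp[OF _ quotient_mapD(1)[OF q[OF signature_sorts(2)[OF \<sigma>]]]])
    then have "adm C (dom_Ob C (par \<Sigma> \<sigma>) (ins \<Sigma> \<sigma>) (car A)) (car ?Q (out \<Sigma> \<sigma>))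
        (\<lambda>x. opn ?Q \<sigma> (?r x))"
    proof (rule adm_transfer)
      fix x assume x: "x \<in> Und C (dom_Ob C (par \<Sigma> \<sigma>) (ins \<Sigma> \<sigma>) (car A))"
      obtain p xs where "x = tuple [p, tuple xs]" "p \<in> Und C (par \<Sigma> \<sigma>)" "args (car A) (ins \<Sigma> \<sigma>) xs"
        by (rule dom_Ob_cases[OF x Alg_car[OF A] Ob])
      then show "?q (out \<Sigma> \<sigma>) (opn A \<sigma> x) = opn ?Q \<sigma> (?r x)"
        using quot_alg_opn[OF A R \<sigma> _ _ Q] by simp
    qed
    moreover have "quotient_map C (dom_Ob C (par \<Sigma> \<sigma>) (ins \<Sigma> \<sigma>) (car A))
        (dom_Ob C (par \<Sigma> \<sigma>) (ins \<Sigma> \<sigma>) (car ?Q)) ?r"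
      unfolding dom_Ob_def using q Ob by (intro quotient_map_prods) auto
    ultimately have "adm C (dom_Ob C (par \<Sigma> \<sigma>) (ins \<Sigma> \<sigma>) (car ?Q)) (car ?Q (out \<Sigma> \<sigma>)) (opn ?Q \<sigma>)"
      by (rule quotient_mapD(3)[rotated])
    moreover have "opn ?Q \<sigma> \<in> extensional (Und C (dom_Ob C (par \<Sigma> \<sigma>) (ins \<Sigma> \<sigma>) (car ?Q)))"
      using \<sigma> by (simp add: quot_alg_def Let_def)
    ultimately show ?thesis
      using Hom_iff_adm[OF dom_Ob_Ob[OF Q Ob] pow_Ob_in[OF Q signature_sorts(2)[OF \<sigma>]]] by blast
  qed
  moreover have "opn ?Q \<in> extensional (syms \<Sigma>)"
    by (simp add: quot_alg_def Let_def)
  ultimately show "?Q \<in> Alg C S \<Sigma>"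
    using Q by (simp add: Alg_def PiE_iff)
  have "?q \<in> extensional S" "\<And>s. s \<in> S \<Longrightarrow> ?q s \<in> extensional (Und C (car A s))"
    by (simp_all add: quot_map_def)
  then have "?q \<in> pow_Hom C S (car A) (car ?Q)"
    unfolding pow_Hom_iff[OF Alg_car[OF A] Q] using quotient_mapD(1)[OF q] by blast
  then show "?q \<in> alg_Hom C S \<Sigma> A ?Q"
    unfolding alg_Hom_iff[OF A] using quot_alg_opn[OF A R _ _ _ Q] by simp
qed

text \<open>Finality of the quotient maps makes \<open>k\<close> admissible in each sort, and their
  surjectivity reduces the morphism condition for \<open>k\<close> to the one for
  \<open>h\<close>.\<close>

lemma quot_alg_factor:
  assumes A: "A \<in> Alg C S \<Sigma>" and R: "congruence C S \<Sigma> A R" and B: "B \<in> Alg C S \<Sigma>"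
    and h: "h \<in> alg_Hom C S \<Sigma> A B"
    and ker: "\<And>s a b. s \<in> S \<Longrightarrow> (a, b) \<in> R s \<Longrightarrow> h s a = h s b"
  obtains k where "k \<in> alg_Hom C S \<Sigma> (quot_alg C S \<Sigma> A R) B"
    "pow_comp C S (car A) k (quot_map C S A R) = h"
proof -
  let ?Q = "quot_alg C S \<Sigma> A R" and ?q = "quot_map C S A R"
  note Q = quot_alg[OF A R] and q = quotient_map_quot_map[OF A, of _ R]
  note cars = Alg_car[OF A] Alg_car[OF B] Alg_car[OF Q(1)]
  \<comment> \<open>A representative is chosen in each class; \<open>ker\<close> makes the value
    independent of it.\<close>
  define k where "k = (\<lambda>s\<in>S. \<lambda>x\<in>Und C (car ?Q s). h s (inv_into (Und C (car A s)) (?q s) x))"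
  have qin: "?q s a \<in> Und C (car ?Q s)" if "s \<in> S" "a \<in> Und C (car A s)" for s a
    using quotient_mapD(2)[OF q] that by blast
  have eq: "h s (inv_into (Und C (car A s)) (?q s) (?q s a)) = h s a"
    if "s \<in> S" "a \<in> Und C (car A s)" for s a
  proof -
    have "inv_into (Und C (car A s)) (?q s) (?q s a) \<in> Und C (car A s)"
      "?q s (inv_into (Und C (car A s)) (?q s) (?q s a)) = ?q s a"
      using that by (auto intro: inv_into_into f_inv_into_f)
    then show ?thesis
      using ker quot_map_eq_iff[OF R] that by blast
  qed
  have kq: "k s (?q s a) = h s a" if "s \<in> S" "a \<in> Und C (car A s)" for s a
    using eq qin that by (simp add: k_def)
  have "k \<in> pow_Hom C S (car ?Q) (car B)"
    unfolding k_def
  proof (rule restrict_pow_Hom[OF cars(3,2)])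
    fix s assume s: "s \<in> S"
    have "adm C (car A s) (car B s) (\<lambda>a. h s (inv_into (Und C (car A s)) (?q s) (?q s a)))"
      using pow_Hom_adm[OF alg_Hom_pow_Hom[OF h] cars(1,2) s] eq[OF s] adm_transfer[of C _ _ "h s"]
      by simp
    then show "adm C (car ?Q s) (car B s) (\<lambda>x. h s (inv_into (Und C (car A s)) (?q s) x))"
      using quotient_mapD(3)[OF q[OF s], of "car B s" "\<lambda>x. h s (inv_into (Und C (car A s)) (?q s) x)"]
      by blast
  qed
  moreover have "k (out \<Sigma> \<sigma>) (opn ?Q \<sigma> (tuple [p, tuple ys])) =
      opn B \<sigma> (tuple [p, tuple (map2 k (ins \<Sigma> \<sigma>) ys)])"
    if \<sigma>: "\<sigma> \<in> syms \<Sigma>" and p: "p \<in> Und C (par \<Sigma> \<sigma>)" and ys: "args (car ?Q) (ins \<Sigma> \<sigma>) ys" for \<sigma> p ys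
  proof -
    obtain xs where xs: "args (car A) (ins \<Sigma> \<sigma>) xs" "map2 ?q (ins \<Sigma> \<sigma>) xs = ys"
      using args_surj[OF ys, of ?q "car A"] quotient_mapD(2)[OF q] signature_sorts(1)[OF \<sigma>] by blast
    have "map2 k (ins \<Sigma> \<sigma>) ys = map2 h (ins \<Sigma> \<sigma>) xs"
      using xs kq signature_sorts(1)[OF \<sigma>]
      by (intro nth_equalityI) (auto simp: args_def list_all2_conv_all_nth subset_iff)
    moreover have "h (out \<Sigma> \<sigma>) (opn A \<sigma> (tuple [p, tuple xs])) =
        opn B \<sigma> (tuple [p, tuple (map2 h (ins \<Sigma> \<sigma>) xs)])"
      using h \<sigma> p xs(1) unfolding alg_Hom_iff[OF A] by blast
    ultimately show ?thesis
      using quot_alg_opn[OF A R \<sigma> p xs(1) cars(3)] xs(2) kq[OF signature_sorts(2)[OF \<sigma>] Alg_opn_in[OF A \<sigma> p xs(1)]]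
      by simp
  qed
  ultimately have "k \<in> alg_Hom C S \<Sigma> ?Q B"
    unfolding alg_Hom_iff[OF Q(1)] by blast
  moreover from this have "pow_comp C S (car A) k ?q = h"
    using kq alg_Hom_pow_Hom h Q cars
    by (intro pow_Hom_eqI[OF alg_Hom_pow_Hom[OF alg_Hom_comp[OF A Q(1) B Q(2)]]])
      (auto simp: pow_comp_app)
  ultimately show thesis
    by (rule that)
qed

end


section \<open>The congruence generated by a theory\<close>

locale enriched_theory = enriched_algebras C S \<Sigma>
  for C :: "('u::set_universe, 'v) concrete" and S :: "'s set" and \<Sigma> :: "('f, 's, 'v) enriched_signature" +
  fixes \<E> :: "('u, 'v, 'f, 's) equation set"
  assumes equations: "e \<in> \<E> \<Longrightarrow> algebraic_equation C S \<Sigma> e"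
begin

lemma equation:
  assumes "(\<omega>, \<nu>) \<in> \<E>"
  shows "algebraic_operation C S \<Sigma> \<omega>" "algebraic_operation C S \<Sigma> \<nu>"
    "op_ins \<omega> = op_ins \<nu>" "op_out \<omega> = op_out \<nu>" "op_par \<omega> = op_par \<nu>"
    "set (op_ins \<omega>) \<subseteq> S" "op_out \<omega> \<in> S"
  using equations[OF assms] by (auto simp: algebraic_equation_def algebraic_operation_def)

text \<open>\<open>eval_op_term\<close> removes the syntax: from here on, arguments about the
  equations use naturality of components in place of terms.\<close>

lemma contains_eqs_iff:
  assumes A: "A \<in> Alg C S \<Sigma>"
  shows "contains_eqs C S \<Sigma> \<E> A R \<longleftrightarrow> (\<forall>\<omega> \<nu>. (\<omega>, \<nu>) \<in> \<E> \<longrightarrow>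
    (\<forall>p\<in>Und C (op_par \<omega>). \<forall>xs. args (car A) (op_ins \<omega>) xs \<longrightarrow>
      (component \<omega> A (tuple [p, tuple xs]), component \<nu> A (tuple [p, tuple xs])) \<in> R (op_out \<omega>)))"
    (is "?l \<longleftrightarrow> ?r")
proof -
  have eval: "eval (und_alg C A) vs xs (op_term C S \<Sigma> \<omega> p vs) = component \<omega> A (tuple [p, tuple xs])"
    "eval (und_alg C A) vs xs (op_term C S \<Sigma> \<nu> p vs) = component \<nu> A (tuple [p, tuple xs])"
    if "(\<omega>, \<nu>) \<in> \<E>" "p \<in> Und C (op_par \<omega>)" "distinct vs" "map snd vs = op_ins \<omega>"
      "args (car A) (op_ins \<omega>) xs" for \<omega> \<nu> p vs xs
    using eval_op_term[OF equation(1)[OF that(1)] A] eval_op_term[OF equation(2)[OF that(1)] A] that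
      equation(3-5)[OF that(1)] by simp_all
  have args_vs: "xs \<in> listset (map (\<lambda>x. Und C (car A (snd x))) vs) \<longleftrightarrow> args (car A) (map snd vs) xs" for xs and vs :: "'s var list"
    by (simp add: args_listset[symmetric] comp_def)
  show ?thesis
  proof
    assume l: ?l
    show ?r
    proof (intro allI impI ballI)
      fix \<omega> \<nu> p xs assume *: "(\<omega>, \<nu>) \<in> \<E>" "p \<in> Und C (op_par \<omega>)" "args (car A) (op_ins \<omega>) xs"
      \<comment> \<open>\<open>und_eqs\<close> ranges over all contexts; numbering the positions
        produces one whose variables are distinct even if sorts repeat.\<close>
      let ?vs = "zip [0..<length (op_ins \<omega>)] (op_ins \<omega>)"
      have vs: "distinct ?vs" "map snd ?vs = op_ins \<omega>"
        by (simp_all add: distinct_zipI1)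
      have "(?vs, op_term C S \<Sigma> \<omega> p ?vs, op_term C S \<Sigma> \<nu> p ?vs, op_out \<omega>) \<in> und_eqs C S \<Sigma> \<E>"
        using * vs unfolding und_eqs_def by blast
      moreover have "xs \<in> listset (map (\<lambda>x. Und C (car A (snd x))) ?vs)"
        unfolding args_vs vs(2) by (rule *(3))
      ultimately have "(eval (und_alg C A) ?vs xs (op_term C S \<Sigma> \<omega> p ?vs),
          eval (und_alg C A) ?vs xs (op_term C S \<Sigma> \<nu> p ?vs)) \<in> R (op_out \<omega>)"
        using l unfolding contains_eqs_def by fast
      then show "(component \<omega> A (tuple [p, tuple xs]), component \<nu> A (tuple [p, tuple xs])) \<in> R (op_out \<omega>)"
        unfolding eval[OF *(1,2) vs *(3)] .
    qed
  next
    assume r: ?r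
    show ?l
      unfolding contains_eqs_def
    proof (clarify, unfold args_vs)
      fix vs t t' s xs
      assume e: "(vs, t, t', s) \<in> und_eqs C S \<Sigma> \<E>" and xs: "args (car A) (map snd vs) xs"
      from e obtain \<omega> \<nu> p where *: "(\<omega>, \<nu>) \<in> \<E>" "p \<in> Und C (op_par \<omega>)" "distinct vs" "map snd vs = op_ins \<omega>"
        and t: "t = op_term C S \<Sigma> \<omega> p vs" "t' = op_term C S \<Sigma> \<nu> p vs" "s = op_out \<omega>"
        unfolding und_eqs_def by blast
      have xs: "args (car A) (op_ins \<omega>) xs"
        using xs *(4) by simp
      show "(eval (und_alg C A) vs xs t, eval (und_alg C A) vs xs t') \<in> R s"
        unfolding t eval[OF * xs] using r *(1,2) xs by blast
    qed
  qed
qed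

text \<open>Naturality along \<open>h\<close> carries the two sides of an equation to
  \<open>B\<close>, where the components coincide.\<close>

lemma kernel_congruence:
  assumes A: "A \<in> Alg C S \<Sigma>" and B: "B \<in> TAlg C S \<Sigma> \<E>" and h: "h \<in> alg_Hom C S \<Sigma> A B"
  defines "K \<equiv> \<lambda>s. {(a, b). a \<in> Und C (car A s) \<and> b \<in> Und C (car A s) \<and> h s a = h s b}"
  shows "congruence C S \<Sigma> A K" "contains_eqs C S \<Sigma> \<E> A K"
proof -
  have B': "B \<in> Alg C S \<Sigma>"
    using B by (simp add: TAlg_def)
  show "congruence C S \<Sigma> A K"
    unfolding congruence_def
  proof (intro conjI ballI allI impI)
    show "equiv (Und C (car A s)) (K s)" for s
      unfolding K_def by (intro equivI) (auto simp: refl_on_def sym_def trans_def)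
    fix \<sigma> p as bs
    assume \<sigma>: "\<sigma> \<in> syms \<Sigma>" and p: "p \<in> Und C (par \<Sigma> \<sigma>)"
      and len: "length as = length (ins \<Sigma> \<sigma>)" "length bs = length (ins \<Sigma> \<sigma>)"
      and K: "\<forall>i<length (ins \<Sigma> \<sigma>). (as ! i, bs ! i) \<in> K (ins \<Sigma> \<sigma> ! i)"
    have as: "args (car A) (ins \<Sigma> \<sigma>) as" and bs: "args (car A) (ins \<Sigma> \<sigma>) bs"
      using len K by (auto simp: args_def list_all2_conv_all_nth K_def)
    have "map2 h (ins \<Sigma> \<sigma>) as = map2 h (ins \<Sigma> \<sigma>) bs"
      using len K by (intro nth_equalityI) (auto simp: K_def)
    moreover have "h (out \<Sigma> \<sigma>) (opn A \<sigma> (tuple [p, tuple xs])) =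
        opn B \<sigma> (tuple [p, tuple (map2 h (ins \<Sigma> \<sigma>) xs)])" if "args (car A) (ins \<Sigma> \<sigma>) xs" for xs
      using h \<sigma> p that unfolding alg_Hom_iff[OF A] by blast
    ultimately show "(opn A \<sigma> (tuple [p, tuple as]), opn A \<sigma> (tuple [p, tuple bs])) \<in> K (out \<Sigma> \<sigma>)"
      using Alg_opn_in[OF A \<sigma> p] as bs by (simp add: K_def)
  qed
  show "contains_eqs C S \<Sigma> \<E> A K"
    unfolding contains_eqs_iff[OF A]
  proof (intro allI impI ballI)
    fix \<omega> \<nu> p xs
    assume e: "(\<omega>, \<nu>) \<in> \<E>" and p: "p \<in> Und C (op_par \<omega>)" and xs: "args (car A) (op_ins \<omega>) xs"
    note ops = equation[OF e]
    have "component \<omega> B = component \<nu> B"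
      using B e by (auto simp: TAlg_def)
    then have "h (op_out \<omega>) (component \<omega> A (tuple [p, tuple xs])) = h (op_out \<nu>) (component \<nu> A (tuple [p, tuple xs]))"
      using algebraic_operation_natural[OF ops(1) A B' h] algebraic_operation_natural[OF ops(2) A B' h]
        p xs ops(3,5) by simp
    then show "(component \<omega> A (tuple [p, tuple xs]), component \<nu> A (tuple [p, tuple xs])) \<in> K (op_out \<omega>)"
      using algebraic_operation_in[OF ops(1) A] algebraic_operation_in[OF ops(2) A] p xs ops(3-5)
      by (simp add: K_def)
  qed
qed

text \<open>Ensures that the intersection in \<open>gen_congruence\<close> runs over a nonempty
  family; an empty intersection would be \<open>UNIV\<close> and need not lie in the
  carriers.\<close>

lemma total_congruence:
  assumes A: "A \<in> Alg C S \<Sigma>"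
  defines "K \<equiv> \<lambda>s. Und C (car A s) \<times> Und C (car A s)"
  shows "congruence C S \<Sigma> A K" "contains_eqs C S \<Sigma> \<E> A K"
proof -
  show "congruence C S \<Sigma> A K"
    unfolding congruence_def
  proof (intro conjI ballI allI impI)
    show "equiv (Und C (car A s)) (K s)" for s
      unfolding K_def by (intro equivI) (auto simp: refl_on_def sym_def trans_def)
    fix \<sigma> p as bs
    assume \<sigma>: "\<sigma> \<in> syms \<Sigma>" and p: "p \<in> Und C (par \<Sigma> \<sigma>)"
      and len: "length as = length (ins \<Sigma> \<sigma>)" "length bs = length (ins \<Sigma> \<sigma>)"
      and K: "\<forall>i<length (ins \<Sigma> \<sigma>). (as ! i, bs ! i) \<in> K (ins \<Sigma> \<sigma> ! i)"
    have "args (car A) (ins \<Sigma> \<sigma>) as" "args (car A) (ins \<Sigma> \<sigma>) bs"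
      using len K by (auto simp: args_def list_all2_conv_all_nth K_def)
    then show "(opn A \<sigma> (tuple [p, tuple as]), opn A \<sigma> (tuple [p, tuple bs])) \<in> K (out \<Sigma> \<sigma>)"
      using Alg_opn_in[OF A \<sigma> p] by (simp add: K_def)
  qed
  show "contains_eqs C S \<Sigma> \<E> A K"
    unfolding contains_eqs_iff[OF A] K_def
    using algebraic_operation_in[OF _ A] equation by (metis SigmaI)
qed

lemma gen_congruence_least:
  assumes "congruence C S \<Sigma> A R" "contains_eqs C S \<Sigma> \<E> A R"
  shows "gen_congruence C S \<Sigma> \<E> A s \<subseteq> R s"
  unfolding gen_congruence_def using assms by blast

text \<open>The closure conditions are of Horn form, hence stable under intersections; the bound by
  the carriers comes from the total congruence.\<close>

lemma gen_congruence:
  assumes A: "A \<in> Alg C S \<Sigma>"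
  shows "congruence C S \<Sigma> A (gen_congruence C S \<Sigma> \<E> A)"
    and "contains_eqs C S \<Sigma> \<E> A (gen_congruence C S \<Sigma> \<E> A)"
proof -
  let ?G = "gen_congruence C S \<Sigma> \<E> A"
  have G: "x \<in> ?G s \<longleftrightarrow> (\<forall>R. congruence C S \<Sigma> A R \<longrightarrow> contains_eqs C S \<Sigma> \<E> A R \<longrightarrow> x \<in> R s)" for x s
    unfolding gen_congruence_def by blast
  show "congruence C S \<Sigma> A ?G"
    unfolding congruence_def
  proof (intro conjI ballI allI impI)
    fix s assume s: "s \<in> S"
    show "equiv (Und C (car A s)) (?G s)"
    proof (rule equivI)
      show "?G s \<subseteq> Und C (car A s) \<times> Und C (car A s)"
        using gen_congruence_least[OF total_congruence[OF A]] .
      show "refl_on (Und C (car A s)) (?G s)"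
        using congruence_equiv[OF _ s] by (auto simp: refl_on_def G equiv_def)
      show "sym (?G s)"
        using congruence_equiv[OF _ s] by (auto simp: sym_def G equiv_def)
      show "trans (?G s)"
        unfolding trans_def G using congruence_equiv[OF _ s] by (meson equivE transE)
    qed
  next
    fix \<sigma> p as bs
    assume \<sigma>: "\<sigma> \<in> syms \<Sigma>" and p: "p \<in> Und C (par \<Sigma> \<sigma>)"
      and len: "length as = length (ins \<Sigma> \<sigma>)" "length bs = length (ins \<Sigma> \<sigma>)"
      and rel: "\<forall>i<length (ins \<Sigma> \<sigma>). (as ! i, bs ! i) \<in> ?G (ins \<Sigma> \<sigma> ! i)"
    show "(opn A \<sigma> (tuple [p, tuple as]), opn A \<sigma> (tuple [p, tuple bs])) \<in> ?G (out \<Sigma> \<sigma>)"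
      unfolding G using congruence_opn[OF _ \<sigma> p len] rel[unfolded G] by blast
  qed
  show "contains_eqs C S \<Sigma> \<E> A ?G"
    unfolding contains_eqs_iff[OF A] G by blast
qed

text \<open>Arguments in the quotient lift to \<open>A\<close>, where the two sides of an equation
  are related; naturality along the quotient morphism turns this relation into an equality.\<close>

lemma quot_alg_TAlg:
  assumes A: "A \<in> Alg C S \<Sigma>" and R: "congruence C S \<Sigma> A R" and eqs: "contains_eqs C S \<Sigma> \<E> A R"
  shows "quot_alg C S \<Sigma> A R \<in> TAlg C S \<Sigma> \<E>"
proof -
  let ?Q = "quot_alg C S \<Sigma> A R" and ?q = "quot_map C S A R"
  note Q = quot_alg[OF A R]
  have "component \<omega> ?Q = component \<nu> ?Q" if e: "(\<omega>, \<nu>) \<in> \<E>" for \<omega> \<nu>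
  proof (rule algebraic_operation_eqI[OF equation(1-5)[OF e] Q(1)])
    note ops = equation[OF e]
    fix p ys assume p: "p \<in> Und C (op_par \<omega>)" and ys: "args (car ?Q) (op_ins \<omega>) ys"
    obtain xs where xs: "args (car A) (op_ins \<omega>) xs" "map2 ?q (op_ins \<omega>) xs = ys"
      using args_surj[OF ys, of ?q "car A"] quotient_mapD(2)[OF quotient_map_quot_map[OF A]] ops(6) by blast
    have "(component \<omega> A (tuple [p, tuple xs]), component \<nu> A (tuple [p, tuple xs])) \<in> R (op_out \<omega>)"
      using eqs[unfolded contains_eqs_iff[OF A]] e p xs(1) by blast
    then have "?q (op_out \<omega>) (component \<omega> A (tuple [p, tuple xs])) = ?q (op_out \<omega>) (component \<nu> A (tuple [p, tuple xs]))"
      using p xs(1) quot_map_eq_iff[OF R ops(7)]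
        algebraic_operation_in[OF ops(1) A] algebraic_operation_in[OF ops(2) A] ops(3-5) by simp
    then show "component \<omega> ?Q (tuple [p, tuple ys]) = component \<nu> ?Q (tuple [p, tuple ys])"
      using algebraic_operation_natural[OF ops(1) A Q(1) Q(2) p xs(1)]
        algebraic_operation_natural[OF ops(2) A Q(1) Q(2), of p xs] p xs ops(3-5) by simp
  qed
  then show ?thesis
    using Q(1) by (auto simp: TAlg_def)
qed

text \<open>Universality is transported along the quotient morphism: existence by factoring the
  morphism out of \<open>A\<close>, uniqueness because that morphism is unique and the quotient maps
  are surjective.\<close>

lemma free_on_quot_alg:
  assumes X: "X \<in> pow_Ob C S" and free: "free_on C S \<Sigma> (Alg C S \<Sigma>) X A \<eta>"
  defines "R \<equiv> gen_congruence C S \<Sigma> \<E> A"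
  shows "free_on C S \<Sigma> (TAlg C S \<Sigma> \<E>) X (quot_alg C S \<Sigma> A R) (pow_comp C S X (quot_map C S A R) \<eta>)"
proof -
  let ?Q = "quot_alg C S \<Sigma> A R" and ?q = "quot_map C S A R"
  have A: "A \<in> Alg C S \<Sigma>" and \<eta>: "\<eta> \<in> pow_Hom C S X (car A)"
    and univ: "\<And>B f. B \<in> Alg C S \<Sigma> \<Longrightarrow> f \<in> pow_Hom C S X (car B) \<Longrightarrow>
      \<exists>!h. h \<in> alg_Hom C S \<Sigma> A B \<and> pow_comp C S X h \<eta> = f"
    using free by (auto simp: free_on_def)
  note R = gen_congruence[OF A, folded R_def]
  note Q = quot_alg[OF A R(1)] and q = quotient_map_quot_map[OF A, of _ R]
  have assoc: "pow_comp C S X k (pow_comp C S X ?q \<eta>) = pow_comp C S X (pow_comp C S (car A) k ?q) \<eta>" for k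
    by (rule pow_comp_assoc[OF \<eta> X Alg_car[OF A]])
  show ?thesis
    unfolding free_on_def
  proof (intro conjI ballI)
    show "?Q \<in> TAlg C S \<Sigma> \<E>"
      by (rule quot_alg_TAlg[OF A R])
    show "pow_comp C S X ?q \<eta> \<in> pow_Hom C S X (car ?Q)"
      by (rule pow_comp_pow_Hom[OF \<eta> alg_Hom_pow_Hom[OF Q(2)] X Alg_car[OF A] Alg_car[OF Q(1)]])
    fix B f assume B: "B \<in> TAlg C S \<Sigma> \<E>" and f: "f \<in> pow_Hom C S X (car B)"
    then have B': "B \<in> Alg C S \<Sigma>"
      by (simp add: TAlg_def)
    obtain h where h: "h \<in> alg_Hom C S \<Sigma> A B" "pow_comp C S X h \<eta> = f"
      using univ[OF B' f] by blast
    have "h s a = h s b" if "(a, b) \<in> R s" for s a b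
      using subsetD[OF gen_congruence_least[OF kernel_congruence[OF A B h(1)]] that[unfolded R_def]] by simp
    then obtain k where k: "k \<in> alg_Hom C S \<Sigma> ?Q B" "pow_comp C S (car A) k ?q = h"
      using quot_alg_factor[OF A R(1) B' h(1)] by blast
    show "\<exists>!k. k \<in> alg_Hom C S \<Sigma> ?Q B \<and> pow_comp C S X k (pow_comp C S X ?q \<eta>) = f"
    proof (rule ex1I[of _ k])
      show "k \<in> alg_Hom C S \<Sigma> ?Q B \<and> pow_comp C S X k (pow_comp C S X ?q \<eta>) = f"
        using k h(2) assoc by simp
      fix k' assume k': "k' \<in> alg_Hom C S \<Sigma> ?Q B \<and> pow_comp C S X k' (pow_comp C S X ?q \<eta>) = f"
      \<comment> \<open>Any competitor, composed with the quotient morphism, is a morphism out of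
        the free algebra that extends \<open>f\<close>, so it equals \<open>h\<close>.\<close>
      then have "pow_comp C S (car A) k' ?q = h"
        using univ[OF B' f] alg_Hom_comp[OF A Q(1) B' Q(2)] assoc h by metis
      then have eq: "k' s (?q s a) = k s (?q s a)" if "s \<in> S" "a \<in> Und C (car A s)" for s a
        using k(2) pow_comp_app[of s a "car A" _ ?q, OF that] by metis
      show "k' = k"
      proof (rule pow_Hom_eqI[OF alg_Hom_pow_Hom alg_Hom_pow_Hom Alg_car[OF Q(1)] Alg_car[OF B']])
        show "k' \<in> alg_Hom C S \<Sigma> ?Q B" "k \<in> alg_Hom C S \<Sigma> ?Q B"
          using k k' by auto
        fix s x assume s: "s \<in> S" and "x \<in> Und C (car ?Q s)"
        then obtain a where "a \<in> Und C (car A s)" "x = ?q s a"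
          using quotient_mapD(2)[OF q[OF s]] by blast
        then show "k' s x = k s x"
          using eq[OF s] by simp
      qed
    qed
  qed
qed

end

theorem theorem4p4p8:
  fixes C :: "('u::set_universe, 'v) concrete"
    and S :: "'s set"
    and \<Sigma> :: "('f, 's, 'v) enriched_signature"
    and \<E> :: "('u, 'v, 'f, 's) equation set"
    and F :: "('s \<Rightarrow> 'v) \<Rightarrow> ('u, 'v, 'f, 's) algebra"
    and \<eta> :: "('s \<Rightarrow> 'v) \<Rightarrow> 's \<Rightarrow> 'u \<Rightarrow> 'u"
    and X :: "'s \<Rightarrow> 'v"
  assumes "topological_category C"
    and "cartesian_closed C"
    and "equational_theory C S \<Sigma> \<E>"
    and "left_adjoint C S \<Sigma> (Alg C S \<Sigma>) F \<eta>"
    and "X \<in> pow_Ob C S"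
  defines "R \<equiv> gen_congruence C S \<Sigma> \<E> (F X)"
  shows "free_on C S \<Sigma> (TAlg C S \<Sigma> \<E>) X
           (quot_alg C S \<Sigma> (F X) R)
           (pow_comp C S X (quot_map C S (F X) R) (\<eta> X))"
proof -
  interpret topological_category C
    by (rule assms(1))
  interpret enriched_theory C S \<Sigma> \<E>
    using assms(2,3) by unfold_locales (auto simp: equational_theory_def)
  show ?thesis
    unfolding R_def using assms(4,5) by (intro free_on_quot_alg) (auto simp: left_adjoint_def)
qed

end
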